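(* Let $n\ge 2$ and let $M^n$ be a Lagrangian submanifold of the complex Euclidean space $\mathbb{C}^n$ (or, of any ambient Kähler manifold $(\tilde M^n,\tilde g,\tilde J)$ of complex dimension $n$) with first normal space $N_1$ of maximal dimension, i.e. $\dim N_1=n=\operatorname{codim} M^n$. Then $M^n$ admits an adapted orthonormal frame field $$\tilde{\mathcal F}=\{F_1,F_2,\dots,F_n,\ \eta_1=\tilde J F_1,\ \eta_2=\tilde J F_2,\dots,\eta_n=\tilde J F_n\}$$ in $\mathbb{C}^n$ (respectively in $\tilde M^n$) along $M^n$, of which the $n$ tangential vector fields $F_1,\dots,F_n$ are the principal Casorati tangential vector fields of $M^n$ and of which the $n$ normal vector fields $\eta_1,\dots,\eta_n$ are the principal Casorati normal vector fields of $M^n$, and the corresponding tangential and normal principal Casorati curvatures are equal: $c_i^T=c_i^\perp$ for all $i\in\{1,\dots,n\}$.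
   Context: Let $(\tilde M^n,\tilde g,\tilde J)$ be a Kähler manifold of complex dimension $n$ (real dimension $2n$): $\tilde J^2=-I$, $\tilde g(\tilde J V,\tilde J W)=\tilde g(V,W)$, and $\tilde\nabla\tilde J=0$ for the Levi-Civita connection $\tilde\nabla$ of $\tilde g$. The space $\mathbb{C}^n=(\mathbb{E}^{2n},\tilde J)$ with its standard structure is an example. A submanifold $M^n$ of $\tilde M^n$ is Lagrangian if its real dimension is $n$ and $\tilde J(T_pM)=T_p^\perp M$ for all $p\in M$. It carries the induced metric $g$. An adapted orthonormal frame field along $M^n$ is an orthonormal frame field of $\tilde M^n$ along $M^n$ whose first $n$ vector fields are tangent to $M^n$ and whose last $n$ are normal to $M^n$. Second fundamental form and shape operators: $h(X,Y)$ is the normal component of $\tilde\nabla_XY$ for tangent vector fields $X,Y$. For a normal vector field $\xi$, $A_\xi$ is the symmetric endomorphism of the tangent bundle with $g(A_\xi X,Y)=\tilde g(h(X,Y),\xi)$. First normal space: $N_1\subset T^\perp M$ is the linear span of $\{h(X,Y): X,Y\in TM\}$; equivalently, it is the orthogonal complement in $T^\perp M$ of $\{\xi\in T^\perp M: A_\xi=0\}$. Casorati operator (tangential): $A^C=\sum_{\alpha=1}^n A_{\xi_\alpha}^2\colon TM\to TM$, where $\xi_1,\dots,\xi_n$ is any orthonormal normal frame field; it does not depend on this choice. The principal Casorati tangential vector fields $F_i$ and their tangential principal Casorati curvatures $c_i^T$ are orthonormal eigenvector fields and corresponding eigenfunctions of $A^C$: $A^CF_i=c_i^TF_i$. Trenčevski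 operator (normal): $a\colon T^\perp M\to T^\perp M$ is the symmetric linear operator $a(\zeta)=\sum_{\alpha=1}^n \operatorname{tr}(A_\zeta A_{\xi_\alpha})\,\xi_\alpha$, for any orthonormal normal frame field $\xi_1,\dots,\xi_n$; it does not depend on this choice. The (first) principal Casorati normal vector fields $\eta_i$ and their normal principal Casorati curvatures $c_i^\perp>0$ are orthonormal eigenvector fields spanning $N_1$ and corresponding (positive) eigenfunctions of $a$: $a(\eta_i)=c_i^\perp\eta_i$.
   Formalization: The frame field is shown to exist as a choice at every point, not necessarily smooth, since smooth principal fields can fail to exist where curvatures coincide; whenever the F_i are smooth principal tangential fields on an open set, the frame F_i, JF_i is shown to be smooth with all stated properties. *)

theory Defs
  imports "HOL-Analysis.Analysis"
begin

section \<open>Smooth maps between open subsets of Euclidean spaces\<close>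

text \<open>Used for open \<open>S\<close> only. In finite dimension \<open>Ck_on k S f\<close> then says that \<open>f\<close> is \<open>k\<close> times
  continuously differentiable on \<open>S\<close>.\<close>

primrec Ck_on :: "nat \<Rightarrow> 'a::euclidean_space set \<Rightarrow> ('a \<Rightarrow> 'b::real_normed_vector) \<Rightarrow> bool" where
  "Ck_on 0 S f \<longleftrightarrow> continuous_on S f"
| "Ck_on (Suc k) S f \<longleftrightarrow>
     f differentiable_on S \<and> (\<forall>v. Ck_on k S (\<lambda>x. frechet_derivative f (at x) v))"

definition smooth_on :: "'a::euclidean_space set \<Rightarrow> ('a \<Rightarrow> 'b::real_normed_vector) \<Rightarrow> bool" where
  "smooth_on S f \<longleftrightarrow> (\<forall>k. Ck_on k S f)"

section \<open>Smooth manifolds and tangent vectors\<close>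

text \<open>A chart is a pair of its domain and its coordinate map. A manifold is a whole type, whose
  topology is Hausdorff and second countable, together with a smooth atlas.\<close>

type_synonym ('m, 'e) chart = "'m set \<times> ('m \<Rightarrow> 'e)"

definition chart_inv :: "('m, 'e) chart \<Rightarrow> 'e \<Rightarrow> 'm" where
  "chart_inv c = inv_into (fst c) (snd c)"

definition smooth_atlas ::
  "('m::{t2_space, second_countable_topology}, 'e::euclidean_space) chart set \<Rightarrow> bool" where
  "smooth_atlas A \<longleftrightarrow>
     (\<Union>c\<in>A. fst c) = UNIV \<and>
     (\<forall>c\<in>A. open (fst c) \<and> open (snd c ` fst c) \<and>
        homeomorphism (fst c) (snd c ` fst c) (snd c) (chart_inv c)) \<and>
     (\<forall>c\<in>A. \<forall>d\<in>A. smooth_on (snd c ` (fst c \<inter> fst d)) (snd d \<circ> chart_inv c))"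

text \<open>The tangent space at \<open>p\<close> is the model space \<open>'e\<close>: a vector of \<open>'e\<close>, regarded as a tangent
  vector at \<open>p\<close>, is given by its components in the chart \<open>chart_at A p\<close> selected at \<open>p\<close>. A vector
  field is thus a function \<open>'m \<Rightarrow> 'e\<close>; as the selected chart varies with \<open>p\<close> in an uncontrolled
  way, regularity is always expressed by the components \<open>coords A c p v\<close> in a fixed
  chart \<open>c\<close>.\<close>

definition chart_at :: "('m, 'e) chart set \<Rightarrow> 'm \<Rightarrow> ('m, 'e) chart" where
  "chart_at A p = (SOME c. c \<in> A \<and> p \<in> fst c)"

definition change_chart ::
  "('m, 'e::euclidean_space) chart \<Rightarrow> ('m, 'e) chart \<Rightarrow> 'm \<Rightarrow> 'e \<Rightarrow> 'e" where
  "change_chart c d p = frechet_derivative (snd d \<circ> chart_inv c) (at (snd c p))"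

definition coords ::
  "('m, 'e::euclidean_space) chart set \<Rightarrow> ('m, 'e) chart \<Rightarrow> 'm \<Rightarrow> 'e \<Rightarrow> 'e" where
  "coords A c p v = change_chart (chart_at A p) c p v"

definition from_coords ::
  "('m, 'e::euclidean_space) chart set \<Rightarrow> ('m, 'e) chart \<Rightarrow> 'm \<Rightarrow> 'e \<Rightarrow> 'e" where
  "from_coords A c p u = change_chart c (chart_at A p) p u"

definition smooth_field ::
  "('m, 'e::euclidean_space) chart set \<Rightarrow> 'm set \<Rightarrow> ('m \<Rightarrow> 'e) \<Rightarrow> bool" where
  "smooth_field A U X \<longleftrightarrow>
     (\<forall>c\<in>A. smooth_on (snd c ` (fst c \<inter> U))
        (\<lambda>x. coords A c (chart_inv c x) (X (chart_inv c x))))"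

definition smooth_field_near ::
  "('m::topological_space, 'e::euclidean_space) chart set \<Rightarrow> 'm \<Rightarrow> ('m \<Rightarrow> 'e) \<Rightarrow> bool" where
  "smooth_field_near A p X \<longleftrightarrow> (\<exists>U. open U \<and> p \<in> U \<and> smooth_field A U X)"

section \<open>Kaehler manifolds\<close>

definition local_metric ::
  "('m, 'e::euclidean_space) chart set \<Rightarrow> ('m \<Rightarrow> 'e \<Rightarrow> 'e \<Rightarrow> real) \<Rightarrow> ('m, 'e) chart \<Rightarrow>
   'e \<Rightarrow> 'e \<Rightarrow> 'e \<Rightarrow> real" where
  "local_metric A g c x u v =
     (let p = chart_inv c x in g p (from_coords A c p u) (from_coords A c p v))"

definition local_endo ::
  "('m, 'e::euclidean_space) chart set \<Rightarrow> ('m \<Rightarrow> 'e \<Rightarrow> 'e) \<Rightarrow> ('m, 'e) chart \<Rightarrow>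
   'e \<Rightarrow> 'e \<Rightarrow> 'e" where
  "local_endo A J c x u = (let p = chart_inv c x in coords A c p (J p (from_coords A c p u)))"

definition riemannian_metric ::
  "('m, 'e::euclidean_space) chart set \<Rightarrow> ('m \<Rightarrow> 'e \<Rightarrow> 'e \<Rightarrow> real) \<Rightarrow> bool" where
  "riemannian_metric A g \<longleftrightarrow>
     (\<forall>p. bilinear (g p) \<and> (\<forall>u v. g p u v = g p v u) \<and> (\<forall>u. u \<noteq> 0 \<longrightarrow> g p u u > 0)) \<and>
     (\<forall>c\<in>A. \<forall>u v. smooth_on (snd c ` fst c) (\<lambda>x. local_metric A g c x u v))"

definition almost_complex_structure ::
  "('m, 'e::euclidean_space) chart set \<Rightarrow> ('m \<Rightarrow> 'e \<Rightarrow> 'e) \<Rightarrow> bool" where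
  "almost_complex_structure A J \<longleftrightarrow>
     (\<forall>p. linear (J p) \<and> (\<forall>v. J p (J p v) = - v)) \<and>
     (\<forall>c\<in>A. \<forall>u. smooth_on (snd c ` fst c) (\<lambda>x. local_endo A J c x u))"

text \<open>A connection is given by its Christoffel maps \<open>\<Gamma> c x\<close> in the charts \<open>c\<close>;
  \<open>cov \<Gamma> c X Y\<close> is the covariant derivative of \<open>Y\<close> along \<open>X\<close>, all in components in \<open>c\<close>.\<close>

definition cov ::
  "(('m, 'e::euclidean_space) chart \<Rightarrow> 'e \<Rightarrow> 'e \<Rightarrow> 'e \<Rightarrow> 'e) \<Rightarrow> ('m, 'e) chart \<Rightarrow>
   ('e \<Rightarrow> 'e) \<Rightarrow> ('e \<Rightarrow> 'e) \<Rightarrow> 'e \<Rightarrow> 'e" where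
  "cov \<Gamma> c X Y x = frechet_derivative Y (at x) (X x) + \<Gamma> c x (X x) (Y x)"

text \<open>Torsion-freeness and compatibility with the metric. They determine \<open>\<Gamma> c x\<close> uniquely on every
  chart image, so the smoothness of the Christoffel maps and their transformation law under a
  change of charts need not be required separately.\<close>

definition levi_civita ::
  "('m, 'e::euclidean_space) chart set \<Rightarrow> ('m \<Rightarrow> 'e \<Rightarrow> 'e \<Rightarrow> real) \<Rightarrow>
   (('m, 'e) chart \<Rightarrow> 'e \<Rightarrow> 'e \<Rightarrow> 'e \<Rightarrow> 'e) \<Rightarrow> bool" where
  "levi_civita A g \<Gamma> \<longleftrightarrow>
     (\<forall>c\<in>A. \<forall>x\<in>snd c ` fst c. bilinear (\<Gamma> c x)) \<and>
     (\<forall>c\<in>A. \<forall>X Y. smooth_on (snd c ` fst c) X \<longrightarrow> smooth_on (snd c ` fst c) Y \<longrightarrow>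
        (\<forall>x\<in>snd c ` fst c.
           cov \<Gamma> c X Y x - cov \<Gamma> c Y X x =
           frechet_derivative Y (at x) (X x) - frechet_derivative X (at x) (Y x))) \<and>
     (\<forall>c\<in>A. \<forall>X Y Z. smooth_on (snd c ` fst c) X \<longrightarrow> smooth_on (snd c ` fst c) Y \<longrightarrow>
        smooth_on (snd c ` fst c) Z \<longrightarrow>
        (\<forall>x\<in>snd c ` fst c.
           frechet_derivative (\<lambda>y. local_metric A g c y (Y y) (Z y)) (at x) (X x) =
           local_metric A g c x (cov \<Gamma> c X Y x) (Z x) +
           local_metric A g c x (Y x) (cov \<Gamma> c X Z x)))"

definition parallel_endo ::
  "('m, 'e::euclidean_space) chart set \<Rightarrow> (('m, 'e) chart \<Rightarrow> 'e \<Rightarrow> 'e \<Rightarrow> 'e \<Rightarrow> 'e) \<Rightarrow>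
   ('m \<Rightarrow> 'e \<Rightarrow> 'e) \<Rightarrow> bool" where
  "parallel_endo A \<Gamma> J \<longleftrightarrow>
     (\<forall>c\<in>A. \<forall>X Y. smooth_on (snd c ` fst c) X \<longrightarrow> smooth_on (snd c ` fst c) Y \<longrightarrow>
        (\<forall>x\<in>snd c ` fst c.
           cov \<Gamma> c X (\<lambda>y. local_endo A J c y (Y y)) x = local_endo A J c x (cov \<Gamma> c X Y x)))"

definition kaehler_manifold ::
  "('q::{t2_space, second_countable_topology}, 'e::euclidean_space) chart set \<Rightarrow>
   ('q \<Rightarrow> 'e \<Rightarrow> 'e \<Rightarrow> real) \<Rightarrow> ('q \<Rightarrow> 'e \<Rightarrow> 'e) \<Rightarrow>
   (('q, 'e) chart \<Rightarrow> 'e \<Rightarrow> 'e \<Rightarrow> 'e \<Rightarrow> 'e) \<Rightarrow> bool" where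
  "kaehler_manifold A g J \<Gamma> \<longleftrightarrow>
     smooth_atlas A \<and> riemannian_metric A g \<and> almost_complex_structure A J \<and>
     (\<forall>p v w. g p (J p v) (J p w) = g p v w) \<and>
     levi_civita A g \<Gamma> \<and> parallel_endo A \<Gamma> J"

section \<open>Immersed submanifolds\<close>

definition smooth_map ::
  "('m::topological_space, 'a::euclidean_space) chart set \<Rightarrow>
   ('q::topological_space, 'e::euclidean_space) chart set \<Rightarrow> ('m \<Rightarrow> 'q) \<Rightarrow> bool" where
  "smooth_map B A f \<longleftrightarrow>
     continuous_on UNIV f \<and>
     (\<forall>c\<in>B. \<forall>d\<in>A. smooth_on (snd c ` (fst c \<inter> f -` fst d)) (snd d \<circ> f \<circ> chart_inv c))"

definition diff_map ::
  "('m, 'a::euclidean_space) chart set \<Rightarrow> ('q, 'e::euclidean_space) chart set \<Rightarrow>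
   ('m \<Rightarrow> 'q) \<Rightarrow> 'm \<Rightarrow> 'a \<Rightarrow> 'e" where
  "diff_map B A f p =
     frechet_derivative (snd (chart_at A (f p)) \<circ> f \<circ> chart_inv (chart_at B p))
       (at (snd (chart_at B p) p))"

definition immersion ::
  "('m::{t2_space, second_countable_topology}, 'a::euclidean_space) chart set \<Rightarrow>
   ('q::topological_space, 'e::euclidean_space) chart set \<Rightarrow> ('m \<Rightarrow> 'q) \<Rightarrow> bool" where
  "immersion B A f \<longleftrightarrow> smooth_atlas B \<and> smooth_map B A f \<and> (\<forall>p. inj (diff_map B A f p))"

text \<open>The tangent space of the submanifold at \<open>p\<close>, inside the ambient tangent space at \<open>f p\<close>.\<close>

definition tangent_space ::
  "('m, 'a::euclidean_space) chart set \<Rightarrow> ('q, 'e::euclidean_space) chart set \<Rightarrow>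
   ('m \<Rightarrow> 'q) \<Rightarrow> 'm \<Rightarrow> 'e set" where
  "tangent_space B A f p = range (diff_map B A f p)"

definition normal_space ::
  "('m, 'a::euclidean_space) chart set \<Rightarrow> ('q, 'e::euclidean_space) chart set \<Rightarrow>
   ('q \<Rightarrow> 'e \<Rightarrow> 'e \<Rightarrow> real) \<Rightarrow> ('m \<Rightarrow> 'q) \<Rightarrow> 'm \<Rightarrow> 'e set" where
  "normal_space B A g f p = {\<xi>. \<forall>w\<in>tangent_space B A f p. g (f p) \<xi> w = 0}"

definition normal_part ::
  "('m, 'a::euclidean_space) chart set \<Rightarrow> ('q, 'e::euclidean_space) chart set \<Rightarrow>
   ('q \<Rightarrow> 'e \<Rightarrow> 'e \<Rightarrow> real) \<Rightarrow> ('m \<Rightarrow> 'q) \<Rightarrow> 'm \<Rightarrow> 'e \<Rightarrow> 'e" where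
  "normal_part B A g f p w =
     (THE \<xi>. \<xi> \<in> normal_space B A g f p \<and> w - \<xi> \<in> tangent_space B A f p)"

definition induced_metric ::
  "('m, 'a::euclidean_space) chart set \<Rightarrow> ('q, 'e::euclidean_space) chart set \<Rightarrow>
   ('q \<Rightarrow> 'e \<Rightarrow> 'e \<Rightarrow> real) \<Rightarrow> ('m \<Rightarrow> 'q) \<Rightarrow> 'm \<Rightarrow> 'a \<Rightarrow> 'a \<Rightarrow> real" where
  "induced_metric B A g f p u v = g (f p) (diff_map B A f p u) (diff_map B A f p v)"

definition lagrangian_immersion ::
  "('m::{t2_space, second_countable_topology}, real ^ 'n) chart set \<Rightarrow>
   ('q::topological_space, complex ^ 'n) chart set \<Rightarrow>
   ('q \<Rightarrow> complex ^ 'n \<Rightarrow> complex ^ 'n \<Rightarrow> real) \<Rightarrow> ('q \<Rightarrow> complex ^ 'n \<Rightarrow> complex ^ 'n) \<Rightarrow>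
   ('m \<Rightarrow> 'q) \<Rightarrow> bool" where
  "lagrangian_immersion B A g J f \<longleftrightarrow>
     immersion B A f \<and>
     (\<forall>p. J (f p) ` tangent_space B A f p = normal_space B A g f p)"

text \<open>Vector fields along \<open>f\<close> assign to \<open>p\<close> an ambient tangent vector at \<open>f p\<close>.\<close>

definition smooth_field_along ::
  "('m, 'a::euclidean_space) chart set \<Rightarrow> ('q, 'e::euclidean_space) chart set \<Rightarrow>
   ('m \<Rightarrow> 'q) \<Rightarrow> 'm set \<Rightarrow> ('m \<Rightarrow> 'e) \<Rightarrow> bool" where
  "smooth_field_along B A f U V \<longleftrightarrow>
     (\<forall>c\<in>B. \<forall>d\<in>A. smooth_on (snd c ` (fst c \<inter> U \<inter> f -` fst d))
        (\<lambda>x. coords A d (f (chart_inv c x)) (V (chart_inv c x))))"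

definition cov_along ::
  "('m, 'a::euclidean_space) chart set \<Rightarrow> ('q, 'e::euclidean_space) chart set \<Rightarrow>
   (('q, 'e) chart \<Rightarrow> 'e \<Rightarrow> 'e \<Rightarrow> 'e \<Rightarrow> 'e) \<Rightarrow> ('m \<Rightarrow> 'q) \<Rightarrow>
   ('m \<Rightarrow> 'a) \<Rightarrow> ('m \<Rightarrow> 'e) \<Rightarrow> 'm \<Rightarrow> 'e" where
  "cov_along B A \<Gamma> f X V p =
     (let c = chart_at B p; d = chart_at A (f p) in
        frechet_derivative (\<lambda>x. coords A d (f (chart_inv c x)) (V (chart_inv c x)))
          (at (snd c p)) (X p) +
        \<Gamma> d (snd d (f p)) (diff_map B A f p (X p)) (V p))"

section \<open>Second fundamental form, Casorati and Trencevski operators\<close>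

definition second_fundamental_form ::
  "('m, 'a::euclidean_space) chart set \<Rightarrow> ('q, 'e::euclidean_space) chart set \<Rightarrow>
   ('q \<Rightarrow> 'e \<Rightarrow> 'e \<Rightarrow> real) \<Rightarrow> (('q, 'e) chart \<Rightarrow> 'e \<Rightarrow> 'e \<Rightarrow> 'e \<Rightarrow> 'e) \<Rightarrow> ('m \<Rightarrow> 'q) \<Rightarrow>
   ('m \<Rightarrow> 'a) \<Rightarrow> ('m \<Rightarrow> 'a) \<Rightarrow> 'm \<Rightarrow> 'e" where
  "second_fundamental_form B A g \<Gamma> f X Y p =
     normal_part B A g f p (cov_along B A \<Gamma> f X (\<lambda>q. diff_map B A f q (Y q)) p)"

definition first_normal_space ::
  "('m::topological_space, 'a::euclidean_space) chart set \<Rightarrow> ('q, 'e::euclidean_space) chart set \<Rightarrow>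
   ('q \<Rightarrow> 'e \<Rightarrow> 'e \<Rightarrow> real) \<Rightarrow> (('q, 'e) chart \<Rightarrow> 'e \<Rightarrow> 'e \<Rightarrow> 'e \<Rightarrow> 'e) \<Rightarrow> ('m \<Rightarrow> 'q) \<Rightarrow>
   'm \<Rightarrow> 'e set" where
  "first_normal_space B A g \<Gamma> f p =
     span {second_fundamental_form B A g \<Gamma> f X Y p | X Y.
             smooth_field_near B p X \<and> smooth_field_near B p Y}"

definition shape_operator ::
  "('m::topological_space, 'a::euclidean_space) chart set \<Rightarrow> ('q, 'e::euclidean_space) chart set \<Rightarrow>
   ('q \<Rightarrow> 'e \<Rightarrow> 'e \<Rightarrow> real) \<Rightarrow> (('q, 'e) chart \<Rightarrow> 'e \<Rightarrow> 'e \<Rightarrow> 'e \<Rightarrow> 'e) \<Rightarrow> ('m \<Rightarrow> 'q) \<Rightarrow>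
   'm \<Rightarrow> 'e \<Rightarrow> 'a \<Rightarrow> 'a" where
  "shape_operator B A g \<Gamma> f p \<xi> =
     (THE S. linear S \<and>
        (\<forall>X Y. smooth_field_near B p X \<longrightarrow> smooth_field_near B p Y \<longrightarrow>
           induced_metric B A g f p (S (X p)) (Y p) =
           g (f p) (second_fundamental_form B A g \<Gamma> f X Y p) \<xi>))"

text \<open>From here on the submanifold has dimension and codimension \<open>n = CARD('n)\<close>, so that tangent and
  normal orthonormal frames are both indexed by \<open>'n\<close>.\<close>

definition orthonormal_wrt :: "('e \<Rightarrow> 'e \<Rightarrow> real) \<Rightarrow> ('i \<Rightarrow> 'e) \<Rightarrow> bool" where
  "orthonormal_wrt G E \<longleftrightarrow> (\<forall>i j. G (E i) (E j) = (if i = j then 1 else 0))"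

definition orthonormal_normal_frame ::
  "('m, real ^ 'n) chart set \<Rightarrow> ('q, 'e::euclidean_space) chart set \<Rightarrow>
   ('q \<Rightarrow> 'e \<Rightarrow> 'e \<Rightarrow> real) \<Rightarrow> ('m \<Rightarrow> 'q) \<Rightarrow> 'm \<Rightarrow> ('n \<Rightarrow> 'e) \<Rightarrow> bool" where
  "orthonormal_normal_frame B A g f p \<xi> \<longleftrightarrow>
     orthonormal_wrt (g (f p)) \<xi> \<and> span (range \<xi>) = normal_space B A g f p"

text \<open>Neither of the next two operators depends on the choice of the normal frame.\<close>

definition casorati_operator ::
  "('m::topological_space, real ^ 'n) chart set \<Rightarrow> ('q, 'e::euclidean_space) chart set \<Rightarrow>
   ('q \<Rightarrow> 'e \<Rightarrow> 'e \<Rightarrow> real) \<Rightarrow> (('q, 'e) chart \<Rightarrow> 'e \<Rightarrow> 'e \<Rightarrow> 'e \<Rightarrow> 'e) \<Rightarrow> ('m \<Rightarrow> 'q) \<Rightarrow>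
   'm \<Rightarrow> real ^ 'n \<Rightarrow> real ^ 'n" where
  "casorati_operator B A g \<Gamma> f p u =
     (let \<xi> = (SOME \<xi> :: 'n \<Rightarrow> 'e. orthonormal_normal_frame B A g f p \<xi>);
          S = shape_operator B A g \<Gamma> f p
      in \<Sum>\<alpha>\<in>UNIV. S (\<xi> \<alpha>) (S (\<xi> \<alpha>) u))"

definition trencevski_operator ::
  "('m::topological_space, real ^ 'n) chart set \<Rightarrow> ('q, 'e::euclidean_space) chart set \<Rightarrow>
   ('q \<Rightarrow> 'e \<Rightarrow> 'e \<Rightarrow> real) \<Rightarrow> (('q, 'e) chart \<Rightarrow> 'e \<Rightarrow> 'e \<Rightarrow> 'e \<Rightarrow> 'e) \<Rightarrow> ('m \<Rightarrow> 'q) \<Rightarrow>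
   'm \<Rightarrow> 'e \<Rightarrow> 'e" where
  "trencevski_operator B A g \<Gamma> f p \<zeta> =
     (let \<xi> = (SOME \<xi> :: 'n \<Rightarrow> 'e. orthonormal_normal_frame B A g f p \<xi>);
          S = shape_operator B A g \<Gamma> f p
      in \<Sum>\<alpha>\<in>UNIV. trace (matrix (S \<zeta> \<circ> S (\<xi> \<alpha>))) *\<^sub>R \<xi> \<alpha>)"

definition principal_casorati_tangential ::
  "('m::topological_space, real ^ 'n) chart set \<Rightarrow> ('q, 'e::euclidean_space) chart set \<Rightarrow>
   ('q \<Rightarrow> 'e \<Rightarrow> 'e \<Rightarrow> real) \<Rightarrow> (('q, 'e) chart \<Rightarrow> 'e \<Rightarrow> 'e \<Rightarrow> 'e \<Rightarrow> 'e) \<Rightarrow> ('m \<Rightarrow> 'q) \<Rightarrow>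
   'm set \<Rightarrow> ('n \<Rightarrow> 'm \<Rightarrow> real ^ 'n) \<Rightarrow> ('n \<Rightarrow> 'm \<Rightarrow> real) \<Rightarrow> bool" where
  "principal_casorati_tangential B A g \<Gamma> f U F c \<longleftrightarrow>
     (\<forall>p\<in>U. orthonormal_wrt (induced_metric B A g f p) (\<lambda>i. F i p) \<and>
        (\<forall>i. casorati_operator B A g \<Gamma> f p (F i p) = c i p *\<^sub>R F i p))"

definition principal_casorati_normal ::
  "('m::topological_space, real ^ 'n) chart set \<Rightarrow> ('q, 'e::euclidean_space) chart set \<Rightarrow>
   ('q \<Rightarrow> 'e \<Rightarrow> 'e \<Rightarrow> real) \<Rightarrow> (('q, 'e) chart \<Rightarrow> 'e \<Rightarrow> 'e \<Rightarrow> 'e \<Rightarrow> 'e) \<Rightarrow> ('m \<Rightarrow> 'q) \<Rightarrow>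
   'm set \<Rightarrow> ('n \<Rightarrow> 'm \<Rightarrow> 'e) \<Rightarrow> ('n \<Rightarrow> 'm \<Rightarrow> real) \<Rightarrow> bool" where
  "principal_casorati_normal B A g \<Gamma> f U \<eta> c \<longleftrightarrow>
     (\<forall>p\<in>U. orthonormal_wrt (g (f p)) (\<lambda>i. \<eta> i p) \<and>
        span (range (\<lambda>i. \<eta> i p)) = first_normal_space B A g \<Gamma> f p \<and>
        (\<forall>i. trencevski_operator B A g \<Gamma> f p (\<eta> i p) = c i p *\<^sub>R \<eta> i p \<and> c i p > 0))"

text \<open>The first \<open>n\<close> fields of the frame are indexed by \<open>Inl i\<close>, the last \<open>n\<close> by \<open>Inr i\<close>.\<close>

definition adapted_orthonormal_frame ::
  "('m, real ^ 'n) chart set \<Rightarrow> ('q, complex ^ 'n) chart set \<Rightarrow>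
   ('q \<Rightarrow> complex ^ 'n \<Rightarrow> complex ^ 'n \<Rightarrow> real) \<Rightarrow> ('m \<Rightarrow> 'q) \<Rightarrow> 'm set \<Rightarrow>
   ('n + 'n \<Rightarrow> 'm \<Rightarrow> complex ^ 'n) \<Rightarrow> bool" where
  "adapted_orthonormal_frame B A g f U E \<longleftrightarrow>
     (\<forall>p\<in>U. orthonormal_wrt (g (f p)) (\<lambda>k. E k p) \<and>
        (\<forall>i. E (Inl i) p \<in> tangent_space B A f p) \<and>
        (\<forall>i. E (Inr i) p \<in> normal_space B A g f p))"

section \<open>Complex Euclidean space\<close>

lemma smooth_on_const: "smooth_on S (\<lambda>x. c)"
proof -
  have "Ck_on k S (\<lambda>x. c)" for k
    by (induction k arbitrary: c) (auto simp: frechet_derivative_const)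
  then show ?thesis by (simp add: smooth_on_def)
qed

lemma smooth_on_id: "smooth_on S (\<lambda>x. x)"
proof -
  have "Ck_on k S (\<lambda>x. x)" for k
  proof (cases k)
    case (Suc j)
    have "Ck_on j S (\<lambda>x. v)" for v :: 'a
      using smooth_on_const[of S v] by (simp add: smooth_on_def)
    with Suc show ?thesis by (simp add: frechet_derivative_ident)
  qed simp
  then show ?thesis by (simp add: smooth_on_def)
qed

text \<open>\<open>\<complex>\<^sup>n\<close> with its standard structure is an instance.\<close>

definition flat_atlas :: "('e, 'e) chart set" where
  "flat_atlas = {(UNIV, \<lambda>x. x)}"

lemma ball_flat_atlas: "(\<forall>c\<in>flat_atlas. P c) \<longleftrightarrow> P (UNIV, \<lambda>x. x)"
  by (simp add: flat_atlas_def)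

lemma chart_inv_flat: "chart_inv (UNIV, \<lambda>x. x) = (\<lambda>x. x)"
  by (rule ext) (simp add: chart_inv_def inv_into_f_f[where f = "\<lambda>x. x" and A = UNIV, simplified])

lemma change_chart_flat:
  "change_chart (UNIV, \<lambda>x. x) (UNIV, \<lambda>x. x) p = (\<lambda>v::'e::euclidean_space. v)"
  by (simp add: change_chart_def chart_inv_flat o_def frechet_derivative_ident)

lemma chart_at_flat: "chart_at flat_atlas p = (UNIV, \<lambda>x. x)"
  by (simp add: chart_at_def flat_atlas_def conj_commute cong: conj_cong)

lemma kaehler_manifold_complex_euclidean:
  "kaehler_manifold (flat_atlas :: (complex ^ 'n, complex ^ 'n) chart set)
     (\<lambda>p. inner) (\<lambda>p v. \<chi> i. \<i> * v $ i) (\<lambda>c x u v. 0)"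
proof -
  let ?A = "flat_atlas :: (complex ^ 'n, complex ^ 'n) chart set"
  let ?J = "(\<lambda>v. \<chi> i. \<i> * v $ i) :: complex ^ 'n \<Rightarrow> complex ^ 'n"
  let ?c = "(UNIV, \<lambda>x. x) :: (complex ^ 'n, complex ^ 'n) chart"
  have metric: "local_metric ?A (\<lambda>p. inner) ?c x u v = u \<bullet> v" for x u v
    by (simp add: local_metric_def from_coords_def chart_at_flat change_chart_flat)
  have endo: "local_endo ?A (\<lambda>p. ?J) ?c x u = ?J u" for x u
    by (simp add: local_endo_def coords_def from_coords_def chart_at_flat change_chart_flat)
  have linJ: "linear ?J"
    by (rule linearI) (simp_all add: vec_eq_iff algebra_simps)
  have atlas: "smooth_atlas ?A"
    by (auto simp: smooth_atlas_def flat_atlas_def chart_inv_flat homeomorphism_def o_def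
        smooth_on_id)
  have riem: "riemannian_metric ?A (\<lambda>p. inner)"
    by (simp add: riemannian_metric_def ball_flat_atlas metric inner_commute smooth_on_const
        bilinear_def linear_iff inner_add_left inner_add_right)
  have ac: "almost_complex_structure ?A (\<lambda>p. ?J)"
    unfolding almost_complex_structure_def
  proof (intro conjI allI ballI)
    show "linear ?J" by (fact linJ)
    show "?J (?J v) = - v" for v
      by (simp add: vec_eq_iff flip: mult.assoc)
    fix c :: "(complex ^ 'n, complex ^ 'n) chart" and u
    assume "c \<in> ?A"
    then have "(\<lambda>x. local_endo ?A (\<lambda>p. ?J) c x u) = (\<lambda>x. ?J u)"
      using endo by (intro ext) (simp only: flat_atlas_def singleton_iff)
    then show "smooth_on (snd c ` fst c) (\<lambda>x. local_endo ?A (\<lambda>p. ?J) c x u)"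
      by (simp only: smooth_on_const)
  qed
  have herm: "?J v \<bullet> ?J w = v \<bullet> w" for v w :: "complex ^ 'n"
    by (simp add: inner_vec_def inner_complex_def algebra_simps)
  have diff: "Y differentiable at x" if "smooth_on UNIV Y" for Y :: "complex ^ 'n \<Rightarrow> complex ^ 'n" and x
  proof -
    have "Ck_on (Suc 0) UNIV Y"
      using that by (simp only: smooth_on_def)
    then show ?thesis by (simp add: differentiable_on_def)
  qed
  have lc: "levi_civita ?A (\<lambda>p. inner) (\<lambda>c x u v. 0)"
  proof -
    have "frechet_derivative (\<lambda>y. Y y \<bullet> Z y) (at x) v =
        frechet_derivative Y (at x) v \<bullet> Z x + Y x \<bullet> frechet_derivative Z (at x) v"
      if "smooth_on UNIV Y" "smooth_on UNIV Z" for Y Z :: "complex ^ 'n \<Rightarrow> complex ^ 'n" and x v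
    proof -
      have "((\<lambda>y. Y y \<bullet> Z y) has_derivative
          (\<lambda>v. Y x \<bullet> frechet_derivative Z (at x) v + frechet_derivative Y (at x) v \<bullet> Z x)) (at x)"
        using diff[OF that(1)] diff[OF that(2)]
        by (intro has_derivative_inner) (simp_all add: frechet_derivative_works)
      from frechet_derivative_at[OF this, symmetric] show ?thesis by simp
    qed
    then show ?thesis
      by (simp add: levi_civita_def ball_flat_atlas metric cov_def bilinear_def linear_iff)
  qed
  have par: "parallel_endo ?A (\<lambda>c x u v. 0) (\<lambda>p. ?J)"
  proof -
    have "frechet_derivative (\<lambda>y. ?J (Y y)) (at x) v = ?J (frechet_derivative Y (at x) v)"
      if "smooth_on UNIV Y" for Y :: "complex ^ 'n \<Rightarrow> complex ^ 'n" and x v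
    proof -
      have "((\<lambda>y. ?J (Y y)) has_derivative (\<lambda>v. ?J (frechet_derivative Y (at x) v))) (at x)"
        using diff[OF that, of x] linJ
        unfolding frechet_derivative_works linear_conv_bounded_linear
        by (rule bounded_linear.has_derivative[rotated])
      from frechet_derivative_at[OF this, symmetric] show ?thesis by simp
    qed
    then show ?thesis
      by (simp add: parallel_endo_def cov_def endo ball_flat_atlas)
  qed
  show ?thesis
    unfolding kaehler_manifold_def by (intro conjI allI atlas riem ac herm lc par)
qed

end

theory Submission
  imports Defs
begin

text \<open>Differentiating the identity \<open>\<omega> (df v) (df w) = 0\<close> along the immersion, with \<open>\<omega>\<close> the parallel
  Kaehler form, shows that \<open>g (h u v) (J (df w))\<close> is symmetric in all of \<open>u\<close>, \<open>v\<close>, \<open>w\<close>. Writing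
  \<open>S w\<close> for the shape operator of \<open>J (df w)\<close>, this says \<open>S w u = S u w\<close>, so in an orthonormal frame
  \<open>e\<close> one gets \<open>tr (S w S (e i)) = \<Sum>j. \<langle>S (e j) w, S (e j) (e i)\<rangle>\<close>: the map \<open>J \<circ> df\<close> intertwines the
  Casorati operator with the Trencevski operator. Any orthonormal eigenframe of the former is then
  carried to one of the latter with the same eigenvalues, and these are positive because a
  vector \<open>w\<close> with \<open>S w = 0\<close> gives a normal vector \<open>J (df w)\<close> orthogonal to the first normal space.\<close>

section \<open>Calculus of smooth maps\<close>

text \<open>The two conditions on the connection act separately: torsion-freeness, together with the
  symmetry of second derivatives, makes the Hessian of the immersion symmetric, while metric
  compatibility and parallel \<open>J\<close> make the Kaehler form parallel. Differentiating the
  vanishing pullback produces a relation that is skew in \<open>v\<close> and \<open>w\<close>;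
  since \<open>J\<close> is itself skew for the metric, the two signs cancel and a symmetry is left.
  The obstacle is representation. A tangent vector is stored by its components in a chart that
  varies arbitrarily with the point, and the second fundamental form, the first normal space and the
  shape operators are defined through vector fields or definite descriptions. Everything is
  therefore reduced to one bilinear Hessian in the charts selected at \<open>p\<close> and
  \<open>f p\<close>; neighbouring points enter only through derivatives of local expressions in
  these two fixed charts. Smoothness is phrased by derivatives in fixed directions, whereas tangent
  vectors move with the base point. Expansion over \<open>Basis\<close> bridges this gap
  throughout.\<close>

lemma Ck_on_Suc_imp: "Ck_on (Suc k) S f \<Longrightarrow> Ck_on k S f"
  by (induction k arbitrary: f) (auto intro: differentiable_imp_continuous_on)

lemma Ck_on_subset: "Ck_on k S f \<Longrightarrow> T \<subseteq> S \<Longrightarrow> Ck_on k T f"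
  by (induction k arbitrary: f) (auto intro: continuous_on_subset differentiable_on_subset)

lemma differentiable_on_open_at:
  "open S \<Longrightarrow> f differentiable_on S \<Longrightarrow> x \<in> S \<Longrightarrow> f differentiable (at x)"
  by (simp add: differentiable_on_eq_differentiable_at)

text \<open>Openness is what makes this true: the derivative at \<open>x\<close> depends only on the
  values near \<open>x\<close>, and all of these lie in \<open>S\<close>.\<close>

lemma Ck_on_cong:
  assumes "open S"
  shows "Ck_on k S f \<Longrightarrow> (\<And>x. x \<in> S \<Longrightarrow> f x = g x) \<Longrightarrow> Ck_on k S g"
proof (induction k arbitrary: f g)
  case 0
  then show ?case by (simp cong: continuous_on_cong)
next
  case (Suc k)
  have f: "f differentiable (at x)" if "x \<in> S" for x
    using Suc.prems(1) by (intro differentiable_on_open_at[OF assms _ that]) simp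
  have "g differentiable_on S"
    using Suc.prems by (auto simp: differentiable_on_def intro: differentiable_transform_within[where d = 1])
  moreover have "frechet_derivative f (at x) = frechet_derivative g (at x)" if "x \<in> S" for x
    using frechet_derivative_transform_within_open[OF f[OF that] assms that] Suc.prems(2) by blast
  ultimately show ?case
    using Suc.prems(1) Suc.IH[of "\<lambda>x. frechet_derivative f (at x) v" "\<lambda>x. frechet_derivative g (at x) v" for v]
    by auto
qed

text \<open>\<open>Ck_on\<close> refers to the derivative selected by
  \<open>frechet_derivative\<close>. By uniqueness of derivatives an explicit formula may stand in
  for it, so the product and chain rules can be proved with concrete derivatives.\<close>

lemma Ck_on_SucI:
  assumes "open S"
    and "\<And>x. x \<in> S \<Longrightarrow> (f has_derivative f' x) (at x)"
    and "\<And>v. Ck_on k S (\<lambda>x. f' x v)"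
  shows "Ck_on (Suc k) S f"
proof -
  have "f differentiable_on S"
    using assms(1,2) by (auto simp: differentiable_on_eq_differentiable_at differentiable_def)
  moreover have "Ck_on k S (\<lambda>x. frechet_derivative f (at x) v)" for v
    by (rule Ck_on_cong[OF assms(1,3)]) (simp add: frechet_derivative_at[OF assms(2)])
  ultimately show ?thesis by simp
qed

lemma Ck_on_Suc_has_derivative:
  "open S \<Longrightarrow> Ck_on (Suc k) S f \<Longrightarrow> x \<in> S \<Longrightarrow> (f has_derivative frechet_derivative f (at x)) (at x)"
  by (simp add: differentiable_on_open_at flip: frechet_derivative_works)

lemma Ck_on_add:
  assumes "open S"
  shows "Ck_on k S f \<Longrightarrow> Ck_on k S g \<Longrightarrow> Ck_on k S (\<lambda>x. f x + g x)"
proof (induction k arbitrary: f g)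
  case 0
  then show ?case by (simp add: continuous_on_add)
next
  case (Suc k)
  show ?case
  proof (rule Ck_on_SucI[OF assms])
    show "((\<lambda>x. f x + g x) has_derivative
        (\<lambda>v. frechet_derivative f (at x) v + frechet_derivative g (at x) v)) (at x)" if "x \<in> S" for x
      using Suc.prems that by (intro has_derivative_add Ck_on_Suc_has_derivative[OF assms])
    show "Ck_on k S (\<lambda>x. frechet_derivative f (at x) v + frechet_derivative g (at x) v)" for v
      using Suc by simp
  qed
qed

lemma Ck_on_const: "Ck_on k S (\<lambda>x. c)"
  using smooth_on_const[of S c] by (simp add: smooth_on_def)

lemma Ck_on_sum:
  assumes "open S"
  shows "finite I \<Longrightarrow> (\<And>i. i \<in> I \<Longrightarrow> Ck_on k S (f i)) \<Longrightarrow> Ck_on k S (\<lambda>x. \<Sum>i\<in>I. f i x)"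
  by (induction I rule: finite_induct) (auto simp: Ck_on_const intro: Ck_on_add[OF assms])

text \<open>The product rule reproduces the shape \<open>h (f x) (g x)\<close> with one factor
  differentiated, so the induction has to vary both factors; the undifferentiated factor is used one
  order lower.\<close>

lemma Ck_on_bilinear:
  assumes "open S" and "bounded_bilinear h"
  shows "Ck_on k S f \<Longrightarrow> Ck_on k S g \<Longrightarrow> Ck_on k S (\<lambda>x. h (f x) (g x))"
proof (induction k arbitrary: f g)
  case 0
  then show ?case by (simp add: bounded_bilinear.continuous_on[OF assms(2)])
next
  case (Suc k)
  show ?case
  proof (rule Ck_on_SucI[OF assms(1)])
    show "((\<lambda>x. h (f x) (g x)) has_derivative
        (\<lambda>v. h (f x) (frechet_derivative g (at x) v) + h (frechet_derivative f (at x) v) (g x))) (at x)"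
      if "x \<in> S" for x
      using Suc.prems that
      by (intro bounded_bilinear.FDERIV[OF assms(2)] Ck_on_Suc_has_derivative[OF assms(1)])
    show "Ck_on k S (\<lambda>x. h (f x) (frechet_derivative g (at x) v) + h (frechet_derivative f (at x) v) (g x))" for v
      using Suc Ck_on_Suc_imp[OF Suc.prems(1)] Ck_on_Suc_imp[OF Suc.prems(2)]
      by (intro Ck_on_add[OF assms(1)] Suc.IH) auto
  qed
qed

text \<open>A derivative in a direction that moves with the point becomes a sum of derivatives in
  fixed directions with scalar coefficients. This form is the one accessible to
  \<open>Ck_on\<close>, for instance in the chain rule.\<close>

lemma linear_frechet_expand:
  assumes "f differentiable (at x)"
  shows "frechet_derivative f (at x) v = (\<Sum>j\<in>Basis. (v \<bullet> j) *\<^sub>R frechet_derivative f (at x) j)"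
    (is "?D v = _")
proof -
  have "?D v = ?D (\<Sum>j\<in>Basis. (v \<bullet> j) *\<^sub>R j)"
    by (simp add: euclidean_representation)
  also have "\<dots> = (\<Sum>j\<in>Basis. (v \<bullet> j) *\<^sub>R ?D j)"
    using linear_frechet_derivative[OF assms] by (simp add: linear_sum linear_cmul)
  finally show ?thesis .
qed

lemma Ck_on_compose:
  assumes "open S" "open T"
  shows "Ck_on k T g \<Longrightarrow> Ck_on k S f \<Longrightarrow> f ` S \<subseteq> T \<Longrightarrow> Ck_on k S (\<lambda>x. g (f x))"
proof (induction k arbitrary: g)
  case 0
  then show ?case by (auto intro: continuous_on_compose2)
next
  case (Suc k)
  have g: "g differentiable (at (f x))" if "x \<in> S" for x
    using Suc.prems that by (auto intro: differentiable_on_open_at[OF assms(2)])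
  show ?case
  proof (rule Ck_on_SucI[OF assms(1)])
    fix x assume x: "x \<in> S"
    have "((\<lambda>x. g (f x)) has_derivative
        (\<lambda>v. frechet_derivative g (at (f x)) (frechet_derivative f (at x) v))) (at x)"
      using g[OF x] x Suc.prems(2)
      by (intro has_derivative_compose[OF Ck_on_Suc_has_derivative[OF assms(1)]])
        (auto simp flip: frechet_derivative_works)
    then show "((\<lambda>x. g (f x)) has_derivative
        (\<lambda>v. \<Sum>j\<in>Basis. (frechet_derivative f (at x) v \<bullet> j) *\<^sub>R frechet_derivative g (at (f x)) j)) (at x)"
      by (simp add: linear_frechet_expand[OF g[OF x], symmetric])
  next
    fix v
    have "Ck_on k S (\<lambda>x. frechet_derivative g (at (f x)) j)" for j
      using Suc.prems Ck_on_Suc_imp[OF Suc.prems(2)]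
      by (intro Suc.IH[of "\<lambda>y. frechet_derivative g (at y) j"]) auto
    moreover have "Ck_on k S (\<lambda>x. frechet_derivative f (at x) v \<bullet> j)" for j
      using Suc.prems(2) by (intro Ck_on_bilinear[OF assms(1) bounded_bilinear_inner _ Ck_on_const]) simp
    ultimately show "Ck_on k S (\<lambda>x. \<Sum>j\<in>Basis. (frechet_derivative f (at x) v \<bullet> j) *\<^sub>R
        frechet_derivative g (at (f x)) j)"
      by (intro Ck_on_sum[OF assms(1)] Ck_on_bilinear[OF assms(1) bounded_bilinear_scaleR]) auto
  qed
qed

lemma smooth_on_subset: "smooth_on S f \<Longrightarrow> T \<subseteq> S \<Longrightarrow> smooth_on T f"
  by (auto simp: smooth_on_def intro: Ck_on_subset)

lemma smooth_on_cong:
  "open S \<Longrightarrow> smooth_on S f \<Longrightarrow> (\<And>x. x \<in> S \<Longrightarrow> f x = g x) \<Longrightarrow> smooth_on S g"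
  unfolding smooth_on_def by (metis Ck_on_cong)

lemma smooth_on_sum:
  "open S \<Longrightarrow> finite I \<Longrightarrow> (\<And>i. i \<in> I \<Longrightarrow> smooth_on S (f i)) \<Longrightarrow> smooth_on S (\<lambda>x. \<Sum>i\<in>I. f i x)"
  by (simp add: smooth_on_def Ck_on_sum)

lemma smooth_on_bilinear:
  "open S \<Longrightarrow> bounded_bilinear h \<Longrightarrow> smooth_on S f \<Longrightarrow> smooth_on S g \<Longrightarrow>
    smooth_on S (\<lambda>x. h (f x) (g x))"
  by (simp add: smooth_on_def Ck_on_bilinear)

lemma smooth_on_compose:
  "open S \<Longrightarrow> open T \<Longrightarrow> smooth_on T g \<Longrightarrow> smooth_on S f \<Longrightarrow> f ` S \<subseteq> T \<Longrightarrow>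
    smooth_on S (\<lambda>x. g (f x))"
  by (simp add: smooth_on_def Ck_on_compose)

lemma smooth_on_frechet_derivative:
  "smooth_on S f \<Longrightarrow> smooth_on S (\<lambda>x. frechet_derivative f (at x) v)"
  unfolding smooth_on_def by (metis Ck_on.simps(2))

lemma smooth_on_differentiable:
  assumes "open S" "smooth_on S f" "x \<in> S"
  shows "f differentiable (at x)"
proof -
  have "Ck_on (Suc 0) S f"
    using assms(2) by (simp only: smooth_on_def)
  then show ?thesis
    using assms by (simp add: differentiable_on_open_at)
qed

lemma smooth_on_has_derivative:
  "open S \<Longrightarrow> smooth_on S f \<Longrightarrow> x \<in> S \<Longrightarrow> (f has_derivative frechet_derivative f (at x)) (at x)"
  using smooth_on_differentiable frechet_derivative_works by blast

text \<open>Metrics, endomorphisms and differentials are known to be smooth only on constant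
  vectors. Linearity and a finite basis extend this to smoothly varying arguments.\<close>

lemma smooth_on_linear_combination:
  fixes v :: "'a::euclidean_space \<Rightarrow> 'b::euclidean_space"
  assumes "open S" and "smooth_on S v" and "\<And>j. j \<in> Basis \<Longrightarrow> smooth_on S (\<lambda>x. L x j)"
    and "\<And>x. x \<in> S \<Longrightarrow> linear (L x)"
  shows "smooth_on S (\<lambda>x. L x (v x))"
proof (rule smooth_on_cong[OF assms(1)])
  show "smooth_on S (\<lambda>x. \<Sum>j\<in>Basis. (v x \<bullet> j) *\<^sub>R L x j)"
    using assms(3)
    by (intro smooth_on_sum assms(1) finite_Basis smooth_on_bilinear[OF assms(1) bounded_bilinear_scaleR]
        smooth_on_bilinear[OF assms(1) bounded_bilinear_inner assms(2) smooth_on_const]) auto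
  fix x assume "x \<in> S"
  then have "linear (L x)" by (rule assms(4))
  then have "(\<Sum>j\<in>Basis. (v x \<bullet> j) *\<^sub>R L x j) = L x (\<Sum>j\<in>Basis. (v x \<bullet> j) *\<^sub>R j)"
    by (simp add: linear_sum linear_cmul)
  then show "(\<Sum>j\<in>Basis. (v x \<bullet> j) *\<^sub>R L x j) = L x (v x)"
    by (simp add: euclidean_representation)
qed

text \<open>The one-variable mean value theorem is applied twice: in \<open>s\<close> to the
  difference of \<open>f\<close> between two opposite edges of the parallelogram, then in
  \<open>t\<close> to the \<open>u\<close>-derivative along the segment joining them.\<close>

lemma second_difference_mean_value:
  fixes f :: "'a::real_normed_vector \<Rightarrow> real"
  assumes "h > 0"
    and in_S: "\<And>s t. 0 \<le> s \<Longrightarrow> s \<le> h \<Longrightarrow> 0 \<le> t \<Longrightarrow> t \<le> h \<Longrightarrow> x + s *\<^sub>R u + t *\<^sub>R v \<in> S"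
    and f': "\<And>y. y \<in> S \<Longrightarrow> (f has_derivative f' y) (at y)"
    and f'': "\<And>y. y \<in> S \<Longrightarrow> ((\<lambda>y. f' y u) has_derivative f'' y) (at y)"
  obtains s t where "0 < s" "s < h" "0 < t" "t < h"
    "f (x + h *\<^sub>R u + h *\<^sub>R v) - f (x + h *\<^sub>R u) - f (x + h *\<^sub>R v) + f x =
      h * h * f'' (x + s *\<^sub>R u + t *\<^sub>R v) v"
proof -
  let ?p = "\<lambda>s. f (x + s *\<^sub>R u + h *\<^sub>R v) - f (x + s *\<^sub>R u)"
  have lin: "f' y (r *\<^sub>R w) = r * f' y w" if "y \<in> S" for y r w
    using has_derivative_linear[OF f'[OF that]] by (simp add: linear_cmul)
  have der: "((\<lambda>s. f (x + s *\<^sub>R u + t *\<^sub>R v)) has_real_derivative f' (x + s *\<^sub>R u + t *\<^sub>R v) u) (at s)"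
    if "0 \<le> s" "s \<le> h" "0 \<le> t" "t \<le> h" for s t
  proof -
    have "((\<lambda>s. x + s *\<^sub>R u + t *\<^sub>R v) has_derivative (\<lambda>r. r *\<^sub>R u)) (at s)"
      by (auto intro!: derivative_eq_intros)
    from has_derivative_compose[OF this f'[OF in_S[OF that]]]
    show ?thesis
      by (simp add: has_field_derivative_def lin[OF in_S[OF that]] mult.commute[of _ "f' _ u"] cong: if_cong)
  qed
  have "(?p has_real_derivative f' (x + s *\<^sub>R u + h *\<^sub>R v) u - f' (x + s *\<^sub>R u) u) (at s)"
    if "0 \<le> s" "s \<le> h" for s
    using der[of s h] der[of s 0] that \<open>h > 0\<close> by (auto intro: DERIV_diff)
  from MVT2[OF \<open>h > 0\<close>, of ?p, OF this]
  obtain s where s: "0 < s" "s < h"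
    "?p h - ?p 0 = h * (f' (x + s *\<^sub>R u + h *\<^sub>R v) u - f' (x + s *\<^sub>R u) u)"
    by auto
  have "((\<lambda>t. f' (x + s *\<^sub>R u + t *\<^sub>R v) u) has_real_derivative f'' (x + s *\<^sub>R u + t *\<^sub>R v) v) (at t)"
    if "0 \<le> t" "t \<le> h" for t
  proof -
    have in': "x + s *\<^sub>R u + t *\<^sub>R v \<in> S" using in_S s that by simp
    have "((\<lambda>t. x + s *\<^sub>R u + t *\<^sub>R v) has_derivative (\<lambda>r. r *\<^sub>R v)) (at t)"
      by (auto intro!: derivative_eq_intros)
    from has_derivative_compose[OF this f''[OF in']]
    show ?thesis
      using has_derivative_linear[OF f''[OF in']]
      by (simp add: has_field_derivative_def linear_cmul mult.commute[of _ "f'' _ v"])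
  qed
  from MVT2[OF \<open>h > 0\<close>, of "\<lambda>t. f' (x + s *\<^sub>R u + t *\<^sub>R v) u", OF this]
  obtain t where t: "0 < t" "t < h"
    "f' (x + s *\<^sub>R u + h *\<^sub>R v) u - f' (x + s *\<^sub>R u) u = h * f'' (x + s *\<^sub>R u + t *\<^sub>R v) v"
    by auto
  show thesis
    using that[of s t] s t by (simp add: algebra_simps)
qed

text \<open>The second difference over a parallelogram does not change when \<open>u\<close> and
  \<open>v\<close> are exchanged. Evaluated in the two orders it gives the two mixed derivatives at
  nearby points, and continuity carries the equality to \<open>x\<close>.\<close>

lemma mixed_derivatives_commute:
  fixes f :: "'a::real_normed_vector \<Rightarrow> real"
  assumes "open S" "x \<in> S"
    and f': "\<And>y. y \<in> S \<Longrightarrow> (f has_derivative f' y) (at y)"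
    and fu: "\<And>y. y \<in> S \<Longrightarrow> ((\<lambda>y. f' y u) has_derivative fu y) (at y)"
    and fv: "\<And>y. y \<in> S \<Longrightarrow> ((\<lambda>y. f' y v) has_derivative fv y) (at y)"
    and cont: "continuous_on S (\<lambda>y. fu y v)" "continuous_on S (\<lambda>y. fv y u)"
  shows "fu x v = fv x u"
proof (rule ccontr)
  assume neq: "fu x v \<noteq> fv x u"
  \<comment> \<open>Half the gap: close to \<open>x\<close> each mixed derivative moves by less than
    \<open>e\<close>, hence both together by less than the gap.\<close>
  define e where "e = \<bar>fu x v - fv x u\<bar> / 2"
  have "e > 0" using neq by (simp add: e_def)
  have "isCont (\<lambda>y. fu y v) x" "isCont (\<lambda>y. fv y u) x"
    using cont assms(1,2) by (auto simp: continuous_on_eq_continuous_at)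
  then have "((\<lambda>y. fu y v) \<longlongrightarrow> fu x v) (nhds x)" "((\<lambda>y. fv y u) \<longlongrightarrow> fv x u) (nhds x)"
    unfolding isCont_def tendsto_at_iff_tendsto_nhds[of "\<lambda>y. fu y v"]
      tendsto_at_iff_tendsto_nhds[of "\<lambda>y. fv y u"] .
  then have "\<forall>\<^sub>F y in nhds x. dist (fu y v) (fu x v) < e \<and> dist (fv y u) (fv x u) < e \<and> y \<in> S"
    using \<open>e > 0\<close> assms(1,2)
    by (intro eventually_conj tendstoD eventually_nhds_in_open)
  then obtain d where d: "d > 0"
    "\<And>y. dist y x < d \<Longrightarrow> dist (fu y v) (fu x v) < e \<and> dist (fv y u) (fv x u) < e \<and> y \<in> S"
    unfolding eventually_nhds_metric by blast
  \<comment> \<open>Chosen so that the whole parallelogram with this scale stays in the ball of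
    radius \<open>d\<close> around \<open>x\<close>; the summand 1 keeps the denominator
    positive.\<close>
  define h where "h = d / (norm u + norm v + 1)"
  have pos: "norm u + norm v + 1 > 0"
    by (simp add: add_nonneg_pos)
  have "h > 0"
    using d(1) pos by (simp add: h_def)
  have near: "dist (x + s *\<^sub>R u + t *\<^sub>R v) x < d" if "0 \<le> s" "s \<le> h" "0 \<le> t" "t \<le> h" for s t
  proof -
    have "norm (s *\<^sub>R u + t *\<^sub>R v) \<le> s * norm u + t * norm v"
      using norm_triangle_ineq[of "s *\<^sub>R u" "t *\<^sub>R v"] that by simp
    also have "\<dots> \<le> h * norm u + h * norm v"
      using that by (intro add_mono mult_right_mono) auto
    also have "\<dots> < h * (norm u + norm v + 1)"
      using \<open>h > 0\<close> by (simp add: algebra_simps)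
    also have "\<dots> = d"
      using pos by (simp add: h_def)
    finally show ?thesis
      by (simp add: dist_norm add.assoc)
  qed
  let ?\<Delta> = "f (x + h *\<^sub>R u + h *\<^sub>R v) - f (x + h *\<^sub>R u) - f (x + h *\<^sub>R v) + f x"
  obtain s t where st: "0 < s" "s < h" "0 < t" "t < h" "?\<Delta> = h * h * fu (x + s *\<^sub>R u + t *\<^sub>R v) v"
    using second_difference_mean_value[OF \<open>h > 0\<close>, of x u v S f f' fu] near d f' fu by blast
  have near': "dist (x + t *\<^sub>R v + s *\<^sub>R u) x < d" if "0 \<le> s" "s \<le> h" "0 \<le> t" "t \<le> h" for s t
    using near[OF that] by (simp add: add.commute add.left_commute)
  obtain s' t' where st': "0 < s'" "s' < h" "0 < t'" "t' < h"
    "f (x + h *\<^sub>R v + h *\<^sub>R u) - f (x + h *\<^sub>R v) - f (x + h *\<^sub>R u) + f x = h * h * fv (x + s' *\<^sub>R v + t' *\<^sub>R u) u"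
    using second_difference_mean_value[OF \<open>h > 0\<close>, of x v u S f f' fv] near' d f' fv by blast
  have "?\<Delta> = h * h * fv (x + s' *\<^sub>R v + t' *\<^sub>R u) u"
    using st'(5) by (simp add: algebra_simps)
  then have eq: "fu (x + s *\<^sub>R u + t *\<^sub>R v) v = fv (x + s' *\<^sub>R v + t' *\<^sub>R u) u"
    using st(5) \<open>h > 0\<close> by simp
  have "dist (fu (x + s *\<^sub>R u + t *\<^sub>R v) v) (fu x v) < e" "dist (fv (x + s' *\<^sub>R v + t' *\<^sub>R u) u) (fv x u) < e"
    using d(2) near near' st(1-4) st'(1-4) by simp_all
  then have "dist (fu x v) (fv x u) < e + e"
    using eq by (intro dist_triangle_less_add[of _ "fu (x + s *\<^sub>R u + t *\<^sub>R v) v"]) (simp_all add: dist_commute)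
  then show False
    by (simp add: e_def dist_real_def)
qed

text \<open>The mean value argument is available only for real values, so it is applied to each
  component \<open>f y \<bullet> b\<close>.\<close>

lemma frechet_derivative_symmetric:
  fixes f :: "'a::euclidean_space \<Rightarrow> 'b::euclidean_space"
  assumes "open S" "smooth_on S f" "x \<in> S"
  shows "frechet_derivative (\<lambda>y. frechet_derivative f (at y) u) (at x) v =
    frechet_derivative (\<lambda>y. frechet_derivative f (at y) v) (at x) u"
proof (rule euclidean_eqI)
  fix b :: 'b assume "b \<in> Basis"
  let ?f' = "\<lambda>y. frechet_derivative f (at y)"
  let ?f'' = "\<lambda>w y. frechet_derivative (\<lambda>y. ?f' y w) (at y)"
  have cont: "continuous_on S (\<lambda>y. ?f'' w y z \<bullet> b)" for w z
  proof -
    have "smooth_on S (\<lambda>y. ?f'' w y z)"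
      by (intro smooth_on_frechet_derivative assms)
    then have "Ck_on 0 S (\<lambda>y. ?f'' w y z)"
      unfolding smooth_on_def by blast
    then show ?thesis by (auto intro: continuous_intros)
  qed
  show "?f'' u x v \<bullet> b = ?f'' v x u \<bullet> b"
  proof (rule mixed_derivatives_commute[OF assms(1,3), of "\<lambda>y. f y \<bullet> b" "\<lambda>y w. ?f' y w \<bullet> b"
        u "\<lambda>y w. ?f'' u y w \<bullet> b" v "\<lambda>y w. ?f'' v y w \<bullet> b"])
  qed (intro has_derivative_inner_left smooth_on_has_derivative[OF assms(1)]
      smooth_on_frechet_derivative assms cont | assumption)+
qed

text \<open>Linearity in the direction of differentiation is immediate. Linearity in the other
  argument is the same fact after exchanging the two by symmetry.\<close>

lemma bilinear_second_frechet_derivative: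
  fixes f :: "'a::euclidean_space \<Rightarrow> 'b::euclidean_space"
  assumes "open S" "smooth_on S f" "x \<in> S"
  shows "bilinear (\<lambda>u v. frechet_derivative (\<lambda>y. frechet_derivative f (at y) v) (at x) u)"
proof -
  have "linear (frechet_derivative (\<lambda>y. frechet_derivative f (at y) v) (at x))" for v
    using assms by (intro linear_frechet_derivative smooth_on_differentiable[OF assms(1) smooth_on_frechet_derivative])
  then show ?thesis
    using frechet_derivative_symmetric[OF assms] unfolding bilinear_def by simp
qed

text \<open>Product rule for a differential applied to a moving vector. It serves to differentiate
  \<open>df Y\<close> for a vector field \<open>Y\<close>: one term is the Hessian, the other lies
  in the image of the differential.\<close>

lemma has_derivative_frechet_field:
  fixes f :: "'a::euclidean_space \<Rightarrow> 'b::euclidean_space"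
  assumes S: "open S" "smooth_on S f" "x \<in> S" and V: "(V has_derivative V') (at x)"
  shows "((\<lambda>y. frechet_derivative f (at y) (V y)) has_derivative
    (\<lambda>u. frechet_derivative (\<lambda>y. frechet_derivative f (at y) (V x)) (at x) u +
         frechet_derivative f (at x) (V' u))) (at x)"
proof -
  let ?D = "\<lambda>y. frechet_derivative f (at y)"
  let ?D2 = "\<lambda>u v. frechet_derivative (\<lambda>y. ?D y v) (at x) u"
  have lin: "linear (?D2 u)" for u
    using bilinear_second_frechet_derivative[OF S] by (simp add: bilinear_def)
  have "((\<lambda>y. \<Sum>j\<in>Basis. (V y \<bullet> j) *\<^sub>R ?D y j) has_derivative
      (\<lambda>u. \<Sum>j\<in>Basis. (V x \<bullet> j) *\<^sub>R ?D2 u j + (V' u \<bullet> j) *\<^sub>R ?D x j)) (at x)"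
    by (intro has_derivative_sum has_derivative_scaleR has_derivative_inner_left V
        smooth_on_has_derivative[OF S(1) _ S(3)] smooth_on_frechet_derivative S(2))
  moreover have "(\<Sum>j\<in>Basis. (V x \<bullet> j) *\<^sub>R ?D2 u j + (V' u \<bullet> j) *\<^sub>R ?D x j) = ?D2 u (V x) + ?D x (V' u)" for u
  proof -
    have "(\<Sum>j\<in>Basis. (V x \<bullet> j) *\<^sub>R ?D2 u j) = ?D2 u (\<Sum>j\<in>Basis. (V x \<bullet> j) *\<^sub>R j)"
      by (simp add: linear_sum[OF lin] linear_cmul[OF lin])
    then show ?thesis
      using linear_frechet_expand[OF smooth_on_differentiable[OF S], of "V' u"]
      by (simp add: sum.distrib euclidean_representation)
  qed
  ultimately have "((\<lambda>y. \<Sum>j\<in>Basis. (V y \<bullet> j) *\<^sub>R ?D y j) has_derivative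
      (\<lambda>u. ?D2 u (V x) + ?D x (V' u))) (at x)"
    by simp
  then show ?thesis
    by (rule has_derivative_transform_within_open[OF _ S(1,3)])
      (simp add: linear_frechet_expand[OF smooth_on_differentiable[OF S(1,2)], symmetric])
qed

lemma bilinear_expand:
  fixes h :: "'a::euclidean_space \<Rightarrow> 'b::euclidean_space \<Rightarrow> real"
  assumes "bilinear h"
  shows "h v w = (\<Sum>i\<in>Basis. \<Sum>j\<in>Basis. (v \<bullet> i) * (w \<bullet> j) * h i j)"
proof -
  have l: "linear (\<lambda>v. h v w)" and r: "linear (h v)" for v w
    using assms by (simp_all add: bilinear_def)
  have right: "h i w = (\<Sum>j\<in>Basis. (w \<bullet> j) * h i j)" for i
  proof -
    have "h i w = h i (\<Sum>j\<in>Basis. (w \<bullet> j) *\<^sub>R j)"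
      by (simp add: euclidean_representation)
    then show ?thesis
      by (simp only: linear_sum[OF r] linear_cmul[OF r] real_scaleR_def)
  qed
  have "h v w = h (\<Sum>i\<in>Basis. (v \<bullet> i) *\<^sub>R i) w"
    by (simp add: euclidean_representation)
  also have "\<dots> = (\<Sum>i\<in>Basis. (v \<bullet> i) * h i w)"
    by (simp add: linear_sum[OF l] linear_cmul[OF l])
  also have "\<dots> = (\<Sum>i\<in>Basis. (v \<bullet> i) * (\<Sum>j\<in>Basis. (w \<bullet> j) * h i j))"
    by (simp only: right)
  finally show ?thesis
    by (simp add: sum_distrib_left mult.assoc)
qed

text \<open>Product rule with three moving parts: the base point of the form and its two arguments.
  The derivative of the form is given only for fixed arguments, hence the expansion into basis
  coefficients.\<close>

lemma has_derivative_bilinear_family: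
  fixes h :: "'e::euclidean_space \<Rightarrow> 'a::euclidean_space \<Rightarrow> 'b::euclidean_space \<Rightarrow> real"
  assumes \<phi>: "(\<phi> has_derivative \<phi>') (at x)"
    and V: "(V has_derivative V') (at x)" and W: "(W has_derivative W') (at x)"
    and h': "\<And>a b. ((\<lambda>y. h y a b) has_derivative h' a b) (at (\<phi> x))"
    and S: "open S" "\<phi> x \<in> S" and bil: "\<And>y. y \<in> S \<Longrightarrow> bilinear (h y)"
    and bil': "\<And>z. bilinear (\<lambda>a b. h' a b z)"
  shows "((\<lambda>x. h (\<phi> x) (V x) (W x)) has_derivative
    (\<lambda>u. h' (V x) (W x) (\<phi>' u) + h (\<phi> x) (V' u) (W x) + h (\<phi> x) (V x) (W' u))) (at x)"
proof -
  have "((\<lambda>x. \<Sum>i\<in>Basis. \<Sum>j\<in>Basis. (V x \<bullet> i) * (W x \<bullet> j) * h (\<phi> x) i j) has_derivative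
    (\<lambda>u. \<Sum>i\<in>Basis. \<Sum>j\<in>Basis. (V x \<bullet> i) * (W x \<bullet> j) * h' i j (\<phi>' u) +
        ((V x \<bullet> i) * (W' u \<bullet> j) + (V' u \<bullet> i) * (W x \<bullet> j)) * h (\<phi> x) i j)) (at x)"
    by (intro has_derivative_sum has_derivative_mult has_derivative_inner_left V W has_derivative_compose[OF \<phi> h'])
  moreover have "(\<Sum>i\<in>Basis. \<Sum>j\<in>Basis. (V x \<bullet> i) * (W x \<bullet> j) * h' i j (\<phi>' u) +
        ((V x \<bullet> i) * (W' u \<bullet> j) + (V' u \<bullet> i) * (W x \<bullet> j)) * h (\<phi> x) i j) =
      h' (V x) (W x) (\<phi>' u) + h (\<phi> x) (V' u) (W x) + h (\<phi> x) (V x) (W' u)" for u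
    unfolding bilinear_expand[OF bil', of "V x" "W x"] bilinear_expand[OF bil[OF S(2)], of "V' u"]
      bilinear_expand[OF bil[OF S(2)], of _ "W' u"]
    by (simp add: sum.distrib algebra_simps)
  ultimately have "((\<lambda>x. \<Sum>i\<in>Basis. \<Sum>j\<in>Basis. (V x \<bullet> i) * (W x \<bullet> j) * h (\<phi> x) i j) has_derivative
    (\<lambda>u. h' (V x) (W x) (\<phi>' u) + h (\<phi> x) (V' u) (W x) + h (\<phi> x) (V x) (W' u))) (at x)"
    by simp
  \<comment> \<open>The form is bilinear only over \<open>S\<close>, so the expansion agrees with
    the original function only near \<open>x\<close>.\<close>
  moreover have "\<forall>\<^sub>F y in at x. \<phi> y \<in> S"
    using has_derivative_continuous[OF \<phi>] S unfolding continuous_at by (rule topological_tendstoD)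
  then have "\<forall>\<^sub>F y in at x. (\<Sum>i\<in>Basis. \<Sum>j\<in>Basis. (V y \<bullet> i) * (W y \<bullet> j) * h (\<phi> y) i j) = h (\<phi> y) (V y) (W y)"
    by eventually_elim (simp add: bilinear_expand[OF bil, symmetric])
  ultimately show ?thesis
    by (rule has_derivative_transform_eventually) (simp_all add: bilinear_expand[OF bil[OF S(2)], symmetric])
qed

section \<open>Inner product forms and orthonormal frames\<close>

text \<open>The metric at a point need not be the inner product of the model space. Orthonormality,
  traces and the spectral theorem are therefore treated relative to an arbitrary positive definite
  form.\<close>

definition inner_product_form :: "('a::euclidean_space \<Rightarrow> 'a \<Rightarrow> real) \<Rightarrow> bool" where
  "inner_product_form G \<longleftrightarrow>
     bilinear G \<and> (\<forall>u v. G u v = G v u) \<and> (\<forall>u. u \<noteq> 0 \<longrightarrow> G u u > 0)"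

lemma inner_product_formD:
  assumes "inner_product_form G"
  shows "bilinear G" "G u v = G v u" "u \<noteq> 0 \<Longrightarrow> G u u > 0" "G u u \<ge> 0" "G u u = 0 \<longleftrightarrow> u = 0"
proof -
  show G: "bilinear G" "G u v = G v u" and pos: "u \<noteq> 0 \<Longrightarrow> G u u > 0"
    using assms unfolding inner_product_form_def by blast+
  show "G u u \<ge> 0" "G u u = 0 \<longleftrightarrow> u = 0"
    using pos bilinear_lzero[OF G(1), of u] by (cases "u = 0"; force)+
qed

lemma inner_product_form_ext:
  assumes "inner_product_form G" "\<And>w. G u w = G v w"
  shows "u = v"
  using assms(2)[of "u - v"] inner_product_formD(5)[OF assms(1), of "u - v"]
  by (simp add: bilinear_lsub[OF inner_product_formD(1)[OF assms(1)]])

lemma orthonormal_wrt_sum: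
  fixes E :: "'n::finite \<Rightarrow> 'a::real_vector"
  assumes "bilinear G" "orthonormal_wrt G E"
  shows "G (\<Sum>j\<in>UNIV. a j *\<^sub>R E j) (E i) = a i"
proof -
  have "G (\<Sum>j\<in>UNIV. a j *\<^sub>R E j) (E i) = (\<Sum>j\<in>UNIV. a j * G (E j) (E i))"
    using assms(1) by (simp add: bilinear_def linear_sum[of "\<lambda>x. G x (E i)"] linear_cmul[of "\<lambda>x. G x (E i)"])
  also have "\<dots> = (\<Sum>j\<in>UNIV. if j = i then a j else 0)"
    using assms(2) by (intro sum.cong) (auto simp: orthonormal_wrt_def)
  also have "\<dots> = a i"
    by simp
  finally show ?thesis .
qed

lemma orthonormal_wrt_independent:
  fixes E :: "'n::finite \<Rightarrow> 'a::euclidean_space"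
  assumes "bilinear G" "orthonormal_wrt G E"
  shows "inj E" "independent (range E)"
proof -
  show inj: "inj E"
  proof (rule injI)
    fix i j assume "E i = E j"
    then have "G (E i) (E i) = G (E i) (E j)" by simp
    then show "i = j" using assms(2) by (simp add: orthonormal_wrt_def split: if_splits)
  qed
  show "independent (range E)"
  proof (rule independent_if_scalars_zero)
    fix a x assume sum: "(\<Sum>x\<in>range E. a x *\<^sub>R x) = 0" and "x \<in> range E"
    then obtain i where x: "x = E i" by blast
    have "(\<Sum>j\<in>UNIV. a (E j) *\<^sub>R E j) = 0"
      using sum by (simp add: sum.reindex[OF inj])
    then show "a x = 0"
      using orthonormal_wrt_sum[OF assms, of "\<lambda>j. a (E j)" i] bilinear_lzero[OF assms(1)] x by simp
  qed simp
qed

lemma orthonormal_wrt_span: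
  fixes E :: "'n::finite \<Rightarrow> 'a::euclidean_space"
  assumes "bilinear G" "orthonormal_wrt G E" "range E \<subseteq> V" "subspace V" "dim V = CARD('n)"
  shows "span (range E) = V"
proof (rule subspace_dim_equal)
  have "dim (span (range E)) = card (range E)"
    using orthonormal_wrt_independent(2)[OF assms(1,2)] by (simp add: dim_eq_card_independent)
  also have "\<dots> = CARD('n)"
    using orthonormal_wrt_independent(1)[OF assms(1,2)] by (simp add: card_image)
  finally show "dim V \<le> dim (span (range E))" using assms(5) by simp
qed (use assms(3,4) span_minimal in auto)

lemma orthonormal_wrt_expand:
  fixes E :: "'n::finite \<Rightarrow> 'a::euclidean_space"
  assumes "bilinear G" "orthonormal_wrt G E" "v \<in> span (range E)"
  shows "v = (\<Sum>j\<in>UNIV. G v (E j) *\<^sub>R E j)"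
proof -
  have "range (\<lambda>u. \<Sum>x\<in>range E. u x *\<^sub>R x) = span (range E)"
    by (rule span_finite[symmetric]) simp
  with assms(3) obtain u where "v = (\<Sum>x\<in>range E. u x *\<^sub>R x)"
    by auto
  then have v: "v = (\<Sum>j\<in>UNIV. u (E j) *\<^sub>R E j)"
    by (simp add: sum.reindex[OF orthonormal_wrt_independent(1)[OF assms(1,2)]])
  then have "G v (E j) = u (E j)" for j
    using orthonormal_wrt_sum[OF assms(1,2), of "\<lambda>j. u (E j)" j] by simp
  then show ?thesis using v by simp
qed

lemma orthonormal_wrt_basis_expand:
  fixes E :: "'n::finite \<Rightarrow> real ^ 'n"
  assumes "bilinear G" "orthonormal_wrt G E"
  shows "v = (\<Sum>j\<in>UNIV. G v (E j) *\<^sub>R E j)"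
  using orthonormal_wrt_span[OF assms, of UNIV] by (intro orthonormal_wrt_expand[OF assms]) auto

text \<open>\<open>matrix\<close> uses the standard basis, while \<open>E\<close> is orthonormal for
  \<open>G\<close>. With \<open>P\<close> the passage from coordinates to vectors in the frame
  \<open>E\<close> and \<open>Q\<close> its inverse, cyclicity of the trace turns
  \<open>P Q T\<close> into \<open>Q T P\<close>, whose diagonal entries are the summands.\<close>

lemma trace_orthonormal_wrt:
  fixes E :: "'n::finite \<Rightarrow> real ^ 'n"
  assumes "bilinear G" "orthonormal_wrt G E" "linear T"
  shows "trace (matrix T) = (\<Sum>j\<in>UNIV. G (T (E j)) (E j))"
proof -
  define P :: "real ^ 'n \<Rightarrow> real ^ 'n" where "P x = (\<Sum>j\<in>UNIV. x $ j *\<^sub>R E j)" for x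
  define Q :: "real ^ 'n \<Rightarrow> real ^ 'n" where "Q v = (\<chi> j. G v (E j))" for v
  have linP: "linear P"
    by (rule linearI) (simp_all add: P_def algebra_simps sum.distrib scaleR_sum_right)
  have linQ: "linear Q"
    using assms(1) by (intro linearI) (simp_all add: Q_def vec_eq_iff bilinear_ladd bilinear_lmul)
  have PQ: "P \<circ> Q = id"
    using orthonormal_wrt_basis_expand[OF assms(1,2)] by (simp add: P_def Q_def fun_eq_iff)
  have P_axis: "P (axis j 1) = E j" for j
  proof -
    have "P (axis j 1) = (\<Sum>i\<in>UNIV. if i = j then E i else 0)"
      unfolding P_def by (intro sum.cong) (auto simp: axis_def)
    then show ?thesis by simp
  qed
  have "trace (matrix T) = trace (matrix ((P \<circ> Q) \<circ> T))"
    by (simp add: PQ)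
  also have "\<dots> = trace (matrix P ** matrix (Q \<circ> T))"
    using linP linQ assms(3) by (simp add: matrix_compose linear_compose o_assoc[symmetric])
  also have "\<dots> = trace (matrix (Q \<circ> T) ** matrix P)"
    by (rule trace_mul_sym)
  also have "\<dots> = trace (matrix (Q \<circ> T \<circ> P))"
    using linP linQ assms(3) by (simp add: matrix_compose linear_compose)
  also have "\<dots> = (\<Sum>j\<in>UNIV. G (T (E j)) (E j))"
    by (simp add: trace_def matrix_def P_axis Q_def)
  finally show ?thesis .
qed

section \<open>Spectral theorem relative to an arbitrary inner product form\<close>

lemma bilinear_continuous:
  fixes h :: "'a::euclidean_space \<Rightarrow> 'a \<Rightarrow> real"
  assumes "bilinear h" "linear T"
  shows "continuous_on S (\<lambda>w. h (T w) w)"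
  using bilinear_conv_bounded_bilinear[of h] assms
  by (intro bounded_bilinear.continuous_on[of h] linear_continuous_on continuous_on_id)
    (auto simp: linear_conv_bounded_linear)

text \<open>A maximiser \<open>w\<close> of the Rayleigh quotient on \<open>W\<close> makes the positive semidefinite form
  \<open>\<mu> G - G (T \<cdot>) \<cdot>\<close> vanish at \<open>w\<close>, so \<open>w\<close> lies in the radical of that form.\<close>

lemma self_adjoint_eigenvector_in:
  fixes G :: "'a::euclidean_space \<Rightarrow> 'a \<Rightarrow> real"
  assumes G: "inner_product_form G" and T: "linear T" "\<And>u v. G (T u) v = G u (T v)"
    and W: "subspace W" "W \<noteq> {0}" "\<And>w. w \<in> W \<Longrightarrow> T w \<in> W"
  obtains w \<mu> where "w \<in> W" "w \<noteq> 0" "T w = \<mu> *\<^sub>R w"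
proof -
  note G' = inner_product_formD[OF G]
  note bi = bilinear_ladd[OF G'(1)] bilinear_radd[OF G'(1)] bilinear_lmul[OF G'(1)]
    bilinear_rmul[OF G'(1)] bilinear_lsub[OF G'(1)] bilinear_rsub[OF G'(1)]
  let ?q = "\<lambda>w. G (T w) w / G w w"
  \<comment> \<open>The sphere is the Euclidean one, which is compact for free. The quotient is
    homogeneous of degree 0, so its maximum there is its maximum over all nonzero vectors of
    \<open>W\<close>.\<close>
  let ?K = "W \<inter> sphere 0 1"
  obtain w0 where w0: "w0 \<in> W" "w0 \<noteq> 0"
    using W(1,2) subspace_0 by blast
  have "compact ?K"
    by (simp add: closed_subspace W(1) closed_Int_compact)
  moreover have "w0 /\<^sub>R norm w0 \<in> ?K"
    using w0 W(1) by (simp add: subspace_mul)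
  then have "?K \<noteq> {}" by blast
  moreover have "continuous_on ?K ?q"
  proof (rule continuous_on_divide)
    show "continuous_on ?K (\<lambda>w. G (T w) w)"
      using G'(1) T(1) by (rule bilinear_continuous)
    show "continuous_on ?K (\<lambda>w. G w w)"
      using bilinear_continuous[OF G'(1) linear_ident] by simp
  qed (auto simp: G'(5))
  ultimately obtain w where w: "w \<in> ?K" "\<And>v. v \<in> ?K \<Longrightarrow> ?q v \<le> ?q w"
    using continuous_attains_sup[of ?K ?q] by blast
  define \<mu> where "\<mu> = ?q w"
  have w': "w \<in> W" "w \<noteq> 0" using w(1) by auto
  have Gw: "G w w > 0" using G'(3) w'(2) .
  let ?b = "\<lambda>u v. \<mu> * G u v - G (T u) v"
  have b_nonneg: "?b v v \<ge> 0" if "v \<in> W" for v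
  proof (cases "v = 0")
    case True
    then show ?thesis by (simp add: bilinear_rzero[OF G'(1)])
  next
    case False
    then have "?q (v /\<^sub>R norm v) \<le> \<mu>"
      unfolding \<mu>_def using that W(1) by (intro w(2)) (simp add: subspace_mul)
    moreover have "?q (v /\<^sub>R norm v) = ?q v"
      using False by (simp add: bi linear_cmul[OF T(1)])
    ultimately show ?thesis
      using G'(3)[OF False] by (simp add: pos_divide_le_eq)
  qed
  have b_w: "?b w w = 0"
    using Gw by (simp add: \<mu>_def)
  have b_sym: "?b u v = ?b v u" for u v
    using T(2)[of v u] G'(2)[of u v] G'(2)[of v "T u"] by simp
  have radical: "?b w v = 0" if "v \<in> W" for v
  proof (rule ccontr)
    assume neq: "?b w v \<noteq> 0"
    \<comment> \<open>Near a zero of the form the linear term wins: with \<open>b = ?b w v\<close>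
      and \<open>c = ?b v v\<close>, the value at \<open>w + t v\<close> is
      \<open>2 t b + t t c\<close>, which is negative for this \<open>t\<close> if \<open>b\<close>
      is nonzero. The summand 1 covers the case \<open>c = 0\<close>.\<close>
    define t where "t = - ?b w v / (?b v v + 1)"
    have vv: "?b v v + 1 > 0" using b_nonneg[OF that] by simp
    have "?b (w + t *\<^sub>R v) (w + t *\<^sub>R v) = ?b w w + t * (?b w v + ?b v w) + t * t * ?b v v"
      by (simp add: bi linear_add[OF T(1)] linear_cmul[OF T(1)] algebra_simps)
    also have "\<dots> = 2 * t * ?b w v + t * t * ?b v v"
      using b_w b_sym[of v w] by simp
    also have "\<dots> = - (?b w v)\<^sup>2 * (?b v v + 2) / (?b v v + 1)\<^sup>2"
      using vv unfolding t_def by (simp add: power2_eq_square divide_simps) (simp add: algebra_simps)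
    also have "\<dots> < 0"
      using neq vv b_nonneg[OF that] by (simp add: divide_less_0_iff mult_neg_pos)
    finally have "?b (w + t *\<^sub>R v) (w + t *\<^sub>R v) < 0" .
    moreover have "w + t *\<^sub>R v \<in> W"
      using w'(1) that W(1) by (simp add: subspace_add subspace_mul)
    ultimately show False using b_nonneg[of "w + t *\<^sub>R v"] by linarith
  qed
  \<comment> \<open>Invariance of \<open>W\<close> makes the defect itself an admissible test
    vector, and \<open>?b w\<close> pairs it with itself.\<close>
  have "\<mu> *\<^sub>R w - T w \<in> W"
    using w'(1) W by (simp add: subspace_diff subspace_mul)
  from radical[OF this] have "G (\<mu> *\<^sub>R w - T w) (\<mu> *\<^sub>R w - T w) = 0"
    by (simp add: bi algebra_simps)
  then have "T w = \<mu> *\<^sub>R w" by (simp add: G'(5))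
  with w' show thesis by (rule that)
qed

text \<open>Eigenvectors are collected one at a time. The orthogonal complement of those already
  found is invariant because \<open>T\<close> is self-adjoint, and it is nonzero as long as fewer
  than \<open>DIM('a)\<close> have been found.\<close>

lemma self_adjoint_orthonormal_eigenvectors:
  fixes G :: "'a::euclidean_space \<Rightarrow> 'a \<Rightarrow> real"
  assumes G: "inner_product_form G" and T: "linear T" "\<And>u v. G (T u) v = G u (T v)"
  shows "k \<le> DIM('a) \<Longrightarrow> \<exists>S. finite S \<and> card S = k \<and>
    (\<forall>s\<in>S. \<forall>t\<in>S. G s t = (if s = t then 1 else 0)) \<and> (\<forall>s\<in>S. \<exists>c. T s = c *\<^sub>R s)"
proof (induction k)
  case 0
  then show ?case by (intro exI[of _ "{}"]) simp
next
  case (Suc k)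
  note G' = inner_product_formD[OF G]
  note bi = bilinear_ladd[OF G'(1)] bilinear_radd[OF G'(1)] bilinear_lmul[OF G'(1)]
    bilinear_rmul[OF G'(1)] bilinear_lsub[OF G'(1)] bilinear_rsub[OF G'(1)]
  obtain S where S: "finite S" "card S = k" "\<And>s t. s \<in> S \<Longrightarrow> t \<in> S \<Longrightarrow> G s t = (if s = t then 1 else 0)"
    "\<And>s. s \<in> S \<Longrightarrow> \<exists>c. T s = c *\<^sub>R s"
    using Suc by auto
  let ?W = "{w. \<forall>s\<in>S. G w s = 0}"
  have "span S \<noteq> UNIV"
    using dim_le_card'[OF S(1)] S(2) Suc.prems by (metis dim_UNIV dim_span not_less_eq_eq)
  then obtain x where x: "x \<notin> span S" by blast
  \<comment> \<open>The Gram-Schmidt remainder of a vector outside the span witnesses that the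
    complement is nonzero.\<close>
  define y where "y = x - (\<Sum>s\<in>S. G x s *\<^sub>R s)"
  have "y \<noteq> 0"
  proof
    assume "y = 0"
    then have "x = (\<Sum>s\<in>S. G x s *\<^sub>R s)" by (simp add: y_def)
    moreover have "\<dots> \<in> span S" by (intro span_sum span_mul span_base)
    ultimately show False using x by simp
  qed
  have "y \<in> ?W"
  proof safe
    fix s assume s: "s \<in> S"
    have "G (\<Sum>t\<in>S. G x t *\<^sub>R t) s = (\<Sum>t\<in>S. G x t * G t s)"
      using G'(1) by (simp add: bilinear_def linear_sum[of "\<lambda>u. G u s"] linear_cmul[of "\<lambda>u. G u s"])
    also have "\<dots> = (\<Sum>t\<in>S. if t = s then G x t else 0)"
      using S(3) s by (intro sum.cong) auto
    also have "\<dots> = G x s"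
      using S(1) s by simp
    finally show "G y s = 0"
      by (simp add: y_def bi)
  qed
  have "subspace ?W"
    by (rule subspaceI) (auto simp: bi bilinear_lzero[OF G'(1)])
  moreover have "?W \<noteq> {0}"
    using \<open>y \<in> ?W\<close> \<open>y \<noteq> 0\<close> by blast
  moreover have "T w \<in> ?W" if "w \<in> ?W" for w
  proof safe
    fix s assume s: "s \<in> S"
    then obtain c where "T s = c *\<^sub>R s" using S(4) by blast
    then show "G (T w) s = 0" using that s by (simp add: T(2) bi)
  qed
  ultimately obtain w \<mu> where w: "w \<in> ?W" "w \<noteq> 0" "T w = \<mu> *\<^sub>R w"
    by (rule self_adjoint_eigenvector_in[OF G T]) auto
  define e where "e = w /\<^sub>R sqrt (G w w)"
  have pos: "G w w > 0" using G'(3)[OF w(2)] .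
  have e: "G e e = 1" "\<And>s. s \<in> S \<Longrightarrow> G e s = 0" "\<And>s. s \<in> S \<Longrightarrow> G s e = 0" "T e = \<mu> *\<^sub>R e"
  proof -
    show "G e e = 1"
      using pos by (simp add: e_def bi field_simps)
    show ge: "G e s = 0" if "s \<in> S" for s
      using w(1) that by (simp add: e_def bi)
    show "G s e = 0" if "s \<in> S" for s
      using ge[OF that] G'(2)[of s e] by simp
    show "T e = \<mu> *\<^sub>R e"
      by (simp add: e_def linear_cmul[OF T(1)] w(3))
  qed
  have "e \<notin> S" using e(1,2) by force
  show ?case
    using S e \<open>e \<notin> S\<close> by (intro exI[of _ "insert e S"]) auto
qed

proposition self_adjoint_eigenframe:
  fixes G :: "real ^ 'n \<Rightarrow> real ^ 'n \<Rightarrow> real"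
  assumes G: "inner_product_form G" and T: "linear T" "\<And>u v. G (T u) v = G u (T v)"
  shows "\<exists>(E :: 'n \<Rightarrow> real ^ 'n) c. orthonormal_wrt G E \<and> (\<forall>i. T (E i) = c i *\<^sub>R E i)"
proof -
  obtain S where S: "finite S" "card S = CARD('n)"
    "\<And>s t. s \<in> S \<Longrightarrow> t \<in> S \<Longrightarrow> G s t = (if s = t then 1 else 0)" "\<And>s. s \<in> S \<Longrightarrow> \<exists>c. T s = c *\<^sub>R s"
    using self_adjoint_orthonormal_eigenvectors[OF G T, of "CARD('n)"] by auto
  then obtain E :: "'n \<Rightarrow> real ^ 'n" where E: "bij_betw E UNIV S"
    using finite_same_card_bij[of "UNIV :: 'n set" S] by auto
  then have in_S: "E i \<in> S" for i
    by (auto simp: bij_betw_def)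
  have "\<exists>c. \<forall>i. T (E i) = c i *\<^sub>R E i"
    using S(4)[OF in_S] by (intro choice) simp
  moreover have "orthonormal_wrt G E"
    using E in_S S(3) by (auto simp: orthonormal_wrt_def bij_betw_def inj_eq)
  ultimately show ?thesis by blast
qed

section \<open>Maps between manifolds in charts\<close>

lemma
  assumes "smooth_atlas A" "c \<in> A"
  shows open_chart_domain: "open (fst c)"
    and open_chart_range: "open (snd c ` fst c)"
    and chart_homeomorphism: "homeomorphism (fst c) (snd c ` fst c) (snd c) (chart_inv c)"
  using assms unfolding smooth_atlas_def by blast+

lemma chart_inv_chart: "smooth_atlas A \<Longrightarrow> c \<in> A \<Longrightarrow> p \<in> fst c \<Longrightarrow> chart_inv c (snd c p) = p"
  using chart_homeomorphism by (rule homeomorphism_apply1)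

lemma
  assumes "smooth_atlas A"
  shows chart_at_in_atlas: "chart_at A p \<in> A" and in_chart_at: "p \<in> fst (chart_at A p)"
proof -
  have "\<exists>c. c \<in> A \<and> p \<in> fst c"
    using assms unfolding smooth_atlas_def by blast
  then have "chart_at A p \<in> A \<and> p \<in> fst (chart_at A p)"
    unfolding chart_at_def by (rule someI_ex)
  then show "chart_at A p \<in> A" "p \<in> fst (chart_at A p)" by blast+
qed

lemma open_chart_image:
  assumes "smooth_atlas A" "c \<in> A" "open U"
  shows "open (snd c ` (fst c \<inter> U))"
proof -
  have "openin (top_of_set (snd c ` fst c)) (snd c ` (fst c \<inter> U))"
    using assms(3) by (intro homeomorphism_imp_open_map[OF chart_homeomorphism[OF assms(1,2)]]) (simp add: openin_open_Int)
  then show ?thesis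
    using open_chart_range[OF assms(1,2)] by (rule openin_open_trans)
qed

text \<open>The differential in an arbitrary pair of charts. Both \<open>diff_map\<close> (selected
  charts) and \<open>change_chart\<close> (the map \<open>id\<close>) are instances, so that a
  single chain rule yields all transformation laws.\<close>

definition map_deriv ::
  "('m, 'a::euclidean_space) chart \<Rightarrow> ('q, 'e::euclidean_space) chart \<Rightarrow> ('m \<Rightarrow> 'q) \<Rightarrow> 'm \<Rightarrow> 'a \<Rightarrow> 'e" where
  "map_deriv c d f p = frechet_derivative (snd d \<circ> f \<circ> chart_inv c) (at (snd c p))"

lemma diff_map_eq_map_deriv: "diff_map B A f p = map_deriv (chart_at B p) (chart_at A (f p)) f p"
  by (simp add: diff_map_def map_deriv_def)

lemma change_chart_eq_map_deriv: "change_chart c d p = map_deriv c d id p"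
  by (simp add: change_chart_def map_deriv_def)

lemma smooth_map_id:
  assumes "smooth_atlas A"
  shows "smooth_map A A id"
  using assms by (simp add: smooth_map_def smooth_atlas_def continuous_on_id')

locale manifold_map =
  fixes B :: "('m::{t2_space, second_countable_topology}, 'a::euclidean_space) chart set"
    and A :: "('q::{t2_space, second_countable_topology}, 'e::euclidean_space) chart set"
    and f :: "'m \<Rightarrow> 'q"
  assumes B: "smooth_atlas B" and A: "smooth_atlas A" and f: "smooth_map B A f"
begin

lemma open_domain:
  assumes "c \<in> B" "d \<in> A" "open U"
  shows "open (snd c ` (fst c \<inter> U \<inter> f -` fst d))"
proof -
  have "open (f -` fst d)"
    using f open_chart_domain[OF A assms(2)] by (intro open_vimage) (auto simp: smooth_map_def)
  then show ?thesis
    using open_chart_image[OF B assms(1), of "U \<inter> f -` fst d"] assms(3) by (simp add: Int_assoc open_Int)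
qed

lemma smooth_local_map:
  "c \<in> B \<Longrightarrow> d \<in> A \<Longrightarrow> smooth_on (snd c ` (fst c \<inter> f -` fst d)) (snd d \<circ> f \<circ> chart_inv c)"
  using f by (simp add: smooth_map_def)

lemma local_map_has_derivative:
  assumes "c \<in> B" "d \<in> A" "p \<in> fst c" "f p \<in> fst d"
  shows "(snd d \<circ> f \<circ> chart_inv c has_derivative map_deriv c d f p) (at (snd c p))"
  unfolding map_deriv_def
  using open_domain[OF assms(1,2) open_UNIV] assms
  by (intro smooth_on_has_derivative[OF _ smooth_local_map]) auto

lemma linear_map_deriv:
  "c \<in> B \<Longrightarrow> d \<in> A \<Longrightarrow> p \<in> fst c \<Longrightarrow> f p \<in> fst d \<Longrightarrow> linear (map_deriv c d f p)"
  using local_map_has_derivative by (rule has_derivative_linear)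

lemma linear_diff_map: "linear (diff_map B A f p)"
  unfolding diff_map_eq_map_deriv
  by (intro linear_map_deriv chart_at_in_atlas in_chart_at A B)

lemma smooth_map_deriv_field:
  assumes "c \<in> B" "d \<in> A" "open U" "smooth_on (snd c ` (fst c \<inter> U)) v"
  shows "smooth_on (snd c ` (fst c \<inter> U \<inter> f -` fst d)) (\<lambda>x. map_deriv c d f (chart_inv c x) (v x))"
proof (rule smooth_on_linear_combination[where v = v and L = "\<lambda>x. map_deriv c d f (chart_inv c x)"])
  show op: "open (snd c ` (fst c \<inter> U \<inter> f -` fst d))"
    by (rule open_domain) fact+
  show "smooth_on (snd c ` (fst c \<inter> U \<inter> f -` fst d)) v"
    using assms(4) by (rule smooth_on_subset) blast
  show "linear (map_deriv c d f (chart_inv c x))" if "x \<in> snd c ` (fst c \<inter> U \<inter> f -` fst d)" for x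
    using that assms(1,2) by (auto simp: chart_inv_chart[OF B assms(1)] intro: linear_map_deriv)
  show "smooth_on (snd c ` (fst c \<inter> U \<inter> f -` fst d)) (\<lambda>x. map_deriv c d f (chart_inv c x) j)" for j
  proof (rule smooth_on_cong[OF op])
    show "smooth_on (snd c ` (fst c \<inter> U \<inter> f -` fst d))
        (\<lambda>x. frechet_derivative (snd d \<circ> f \<circ> chart_inv c) (at x) j)"
      by (rule smooth_on_frechet_derivative, rule smooth_on_subset[OF smooth_local_map[OF assms(1,2)]]) blast
  qed (auto simp: map_deriv_def chart_inv_chart[OF B assms(1)])
qed

end

text \<open>The composed local expressions agree with the local expression of
  \<open>h \<circ> f\<close> only where \<open>f\<close> takes values in the middle chart; this set
  is open, which suffices for derivatives.\<close>

lemma map_deriv_compose: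
  assumes "manifold_map B A f" "manifold_map A A' h"
    and "c \<in> B" "d \<in> A" "e \<in> A'" "p \<in> fst c" "f p \<in> fst d" "h (f p) \<in> fst e"
  shows "map_deriv c e (h \<circ> f) p v = map_deriv d e h (f p) (map_deriv c d f p v)"
proof -
  interpret f: manifold_map B A f by fact
  interpret h: manifold_map A A' h by fact
  have "(snd e \<circ> h \<circ> chart_inv d has_derivative map_deriv d e h (f p)) (at ((snd d \<circ> f \<circ> chart_inv c) (snd c p)))"
    using h.local_map_has_derivative[of d e "f p"] assms by (simp add: chart_inv_chart[OF f.B])
  from diff_chain_at[OF f.local_map_has_derivative[OF assms(3,4,6,7)] this]
  have "((snd e \<circ> h \<circ> chart_inv d) \<circ> (snd d \<circ> f \<circ> chart_inv c) has_derivative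
      map_deriv d e h (f p) \<circ> map_deriv c d f p) (at (snd c p))"
    using assms by blast
  then have "(snd e \<circ> (h \<circ> f) \<circ> chart_inv c has_derivative
      map_deriv d e h (f p) \<circ> map_deriv c d f p) (at (snd c p))"
    by (rule has_derivative_transform_within_open[OF _ f.open_domain[OF assms(3,4) open_UNIV]])
      (use assms in \<open>auto simp: chart_inv_chart[OF f.B] chart_inv_chart[OF f.A]\<close>)
  from frechet_derivative_at[OF this] show ?thesis
    by (simp add: map_deriv_def fun_eq_iff)
qed

lemma map_deriv_id_same:
  assumes "smooth_atlas A" "c \<in> A" "p \<in> fst c"
  shows "map_deriv c c id p v = v"
proof -
  have "((\<lambda>x. x) has_derivative (\<lambda>x. x)) (at (snd c p))"
    by (rule has_derivative_ident)
  then have "(snd c \<circ> id \<circ> chart_inv c has_derivative (\<lambda>x. x)) (at (snd c p))"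
    by (rule has_derivative_transform_within_open[OF _ open_chart_range[OF assms(1,2)]])
      (use assms in \<open>auto simp: chart_inv_chart[OF assms(1,2)]\<close>)
  from frechet_derivative_at[OF this] show ?thesis
    by (simp add: map_deriv_def fun_eq_iff)
qed

lemma manifold_map_id: "smooth_atlas A \<Longrightarrow> manifold_map A A id"
  by (simp add: manifold_map_def smooth_map_id)

context
  fixes A :: "('q::{t2_space, second_countable_topology}, 'e::euclidean_space) chart set" and c p
  assumes A: "smooth_atlas A" and c: "c \<in> A" "p \<in> fst c"
begin

lemma coords_eq_map_deriv: "coords A c p v = map_deriv (chart_at A p) c id p v"
  by (simp add: coords_def change_chart_eq_map_deriv)

lemma from_coords_eq_map_deriv: "from_coords A c p v = map_deriv c (chart_at A p) id p v"
  by (simp add: from_coords_def change_chart_eq_map_deriv)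

lemma linear_coords: "linear (coords A c p)" and linear_from_coords: "linear (from_coords A c p)"
  unfolding coords_eq_map_deriv[abs_def] from_coords_eq_map_deriv[abs_def]
  using c by (auto intro!: manifold_map.linear_map_deriv[OF manifold_map_id[OF A]] chart_at_in_atlas[OF A] in_chart_at[OF A])

lemma coords_from_coords: "coords A c p (from_coords A c p v) = v"
  using map_deriv_compose[OF manifold_map_id[OF A] manifold_map_id[OF A] c(1) chart_at_in_atlas[OF A] c(1), where p = p and v = v]
    c in_chart_at[OF A, of p]
  by (simp add: coords_eq_map_deriv from_coords_eq_map_deriv map_deriv_id_same[OF A c])

lemma from_coords_coords: "from_coords A c p (coords A c p v) = v"
  using map_deriv_compose[OF manifold_map_id[OF A] manifold_map_id[OF A] chart_at_in_atlas[OF A, of p] c(1) chart_at_in_atlas[OF A, of p], where p = p and v = v]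
    c in_chart_at[OF A, of p]
  by (simp add: coords_eq_map_deriv from_coords_eq_map_deriv map_deriv_id_same[OF A chart_at_in_atlas[OF A] in_chart_at[OF A]])

end

lemma
  assumes "smooth_atlas A"
  shows coords_chart_at: "coords A (chart_at A p) p v = v"
    and from_coords_chart_at: "from_coords A (chart_at A p) p v = v"
  by (simp_all add: coords_def from_coords_def change_chart_eq_map_deriv
      map_deriv_id_same[OF assms chart_at_in_atlas[OF assms] in_chart_at[OF assms]])

text \<open>This is the field with constant components \<open>v\<close> in the chart
  \<open>c\<close>. In another chart its components are a directional derivative of the transition
  map, evaluated at a smoothly moving point.\<close>

lemma smooth_field_from_coords:
  assumes A: "smooth_atlas A" and c: "c \<in> A"
  shows "smooth_field A (fst c) (\<lambda>q. from_coords A c q v)"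
  unfolding smooth_field_def
proof
  fix c' assume c': "c' \<in> A"
  interpret manifold_map A A id using A by (rule manifold_map_id)
  let ?S = "snd c' ` (fst c' \<inter> fst c)"
  have S: "open ?S"
    using A c' open_chart_domain[OF A c] by (rule open_chart_image)
  have eq: "coords A c' q (from_coords A c q v) = map_deriv c c' id q v"
    if "q \<in> fst c'" "q \<in> fst c" for q
    using map_deriv_compose[OF manifold_map_id[OF A] manifold_map_id[OF A] c chart_at_in_atlas[OF A] c', where p = q and v = v]
      that in_chart_at[OF A, of q] A c c'
    by (simp add: coords_eq_map_deriv from_coords_eq_map_deriv)
  show "smooth_on ?S (\<lambda>x. coords A c' (chart_inv c' x) (from_coords A c (chart_inv c' x) v))"
  proof (rule smooth_on_cong[OF S])
    have "smooth_on (snd c ` (fst c \<inter> fst c')) (\<lambda>y. frechet_derivative (snd c' \<circ> id \<circ> chart_inv c) (at y) v)"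
      using smooth_local_map[OF c c'] by (intro smooth_on_frechet_derivative) simp
    moreover have "smooth_on ?S (snd c \<circ> chart_inv c')"
      using smooth_local_map[OF c' c] by simp
    moreover have "(snd c \<circ> chart_inv c') ` ?S \<subseteq> snd c ` (fst c \<inter> fst c')"
      by (auto simp: chart_inv_chart[OF A c'])
    ultimately show "smooth_on ?S (\<lambda>x. frechet_derivative (snd c' \<circ> id \<circ> chart_inv c)
        (at ((snd c \<circ> chart_inv c') x)) v)"
      using S open_chart_image[OF A c open_chart_domain[OF A c']]
      by (intro smooth_on_compose[of ?S _ "\<lambda>y. frechet_derivative (snd c' \<circ> id \<circ> chart_inv c) (at y) v"])
  next
    fix x assume "x \<in> ?S"
    then show "frechet_derivative (snd c' \<circ> id \<circ> chart_inv c) (at ((snd c \<circ> chart_inv c') x)) v =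
        coords A c' (chart_inv c' x) (from_coords A c (chart_inv c' x) v)"
      by (auto simp: chart_inv_chart[OF A c'] eq map_deriv_def)
  qed
qed

lemma linear_local_endo:
  assumes "smooth_atlas A" "d \<in> A" "y \<in> snd d ` fst d" "linear (J (chart_inv d y))"
  shows "linear (local_endo A J d y)"
proof -
  have "local_endo A J d y = coords A d (chart_inv d y) \<circ> J (chart_inv d y) \<circ> from_coords A d (chart_inv d y)"
    by (simp add: fun_eq_iff local_endo_def Let_def)
  then show ?thesis
    using assms by (auto simp: chart_inv_chart[OF assms(1,2)] intro!: linear_compose linear_coords linear_from_coords)
qed

context manifold_map
begin

text \<open>Frees the differential from the selected charts, which is indispensable when the base
  point varies. Both sides are compared, by the chain rule, with the differential from the selected
  chart of \<open>B\<close> to \<open>d\<close>.\<close>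

lemma coords_diff_map:
  assumes "c \<in> B" "d \<in> A" "p \<in> fst c" "f p \<in> fst d"
  shows "coords A d (f p) (diff_map B A f p u) = map_deriv c d f p (coords B c p u)"
proof -
  have "coords A d (f p) (diff_map B A f p u) = map_deriv (chart_at B p) d f p u"
    using map_deriv_compose[OF manifold_map_axioms manifold_map_id[OF A] chart_at_in_atlas[OF B]
        chart_at_in_atlas[OF A] assms(2), where p = p and v = u] in_chart_at[OF B, of p] in_chart_at[OF A, of "f p"] assms A
    by (simp add: coords_eq_map_deriv diff_map_eq_map_deriv)
  also have "\<dots> = map_deriv c d f p (coords B c p u)"
    using map_deriv_compose[OF manifold_map_id[OF B] manifold_map_axioms chart_at_in_atlas[OF B] assms(1,2), where p = p and v = u]
      in_chart_at[OF B, of p] assms B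
    by (simp add: coords_eq_map_deriv)
  finally show ?thesis .
qed

lemma from_coords_map_deriv:
  assumes "c \<in> B" "d \<in> A" "p \<in> fst c" "f p \<in> fst d"
  shows "from_coords A d (f p) (map_deriv c d f p u) = diff_map B A f p (from_coords B c p u)"
proof -
  have "map_deriv c d f p u = coords A d (f p) (diff_map B A f p (from_coords B c p u))"
    by (simp add: coords_diff_map[OF assms] coords_from_coords[OF B assms(1,3)])
  then show ?thesis
    by (simp add: from_coords_coords[OF A assms(2,4)])
qed

lemma smooth_field_along_diff_map:
  assumes "open U" "smooth_field B U X"
  shows "smooth_field_along B A f U (\<lambda>p. diff_map B A f p (X p))"
  unfolding smooth_field_along_def
proof (intro ballI)
  fix c d assume c: "c \<in> B" and d: "d \<in> A"
  show "smooth_on (snd c ` (fst c \<inter> U \<inter> f -` fst d))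
      (\<lambda>x. coords A d (f (chart_inv c x)) (diff_map B A f (chart_inv c x) (X (chart_inv c x))))"
  proof (rule smooth_on_cong[OF open_domain[OF c d assms(1)]])
    show "smooth_on (snd c ` (fst c \<inter> U \<inter> f -` fst d))
       (\<lambda>x. map_deriv c d f (chart_inv c x) (coords B c (chart_inv c x) (X (chart_inv c x))))"
      using assms c by (intro smooth_map_deriv_field c d) (auto simp: smooth_field_def)
  qed (use c d in \<open>auto simp: chart_inv_chart[OF B c] coords_diff_map\<close>)
qed

lemma smooth_field_along_endo:
  assumes "open U" "smooth_field_along B A f U V" "almost_complex_structure A J"
  shows "smooth_field_along B A f U (\<lambda>p. J (f p) (V p))"
  unfolding smooth_field_along_def
proof (intro ballI)
  fix c d assume c: "c \<in> B" and d: "d \<in> A"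
  let ?S = "snd c ` (fst c \<inter> U \<inter> f -` fst d)" and ?\<phi> = "\<lambda>x. snd d (f (chart_inv c x))"
  let ?V = "\<lambda>x. coords A d (f (chart_inv c x)) (V (chart_inv c x))"
  have S: "open ?S" by (rule open_domain[OF c d assms(1)])
  have image: "?\<phi> ` ?S \<subseteq> snd d ` fst d"
    by (auto simp: chart_inv_chart[OF B c])
  show "smooth_on ?S (\<lambda>x. coords A d (f (chart_inv c x)) (J (f (chart_inv c x)) (V (chart_inv c x))))"
  proof (rule smooth_on_cong[OF S])
    show "smooth_on ?S (\<lambda>x. local_endo A J d (?\<phi> x) (?V x))"
    proof (rule smooth_on_linear_combination[OF S, where v = ?V and L = "\<lambda>x. local_endo A J d (?\<phi> x)"])
      show "smooth_on ?S ?V"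
        using assms(2) c d by (auto simp: smooth_field_along_def)
      show "linear (local_endo A J d (?\<phi> x))" if "x \<in> ?S" for x
        using assms(3) image that
        by (intro linear_local_endo[OF A d]) (auto simp: almost_complex_structure_def)
      have "smooth_on ?S ?\<phi>"
        by (rule smooth_on_subset[OF smooth_local_map[OF c d, unfolded o_def]]) blast
      then show "smooth_on ?S (\<lambda>x. local_endo A J d (?\<phi> x) j)" for j
        using assms(3) d image
        by (intro smooth_on_compose[OF S open_chart_range[OF A d], of "\<lambda>y. local_endo A J d y j"])
          (auto simp: almost_complex_structure_def)
    qed
  qed (use d in \<open>auto simp: chart_inv_chart[OF B c] chart_inv_chart[OF A d] local_endo_def Let_def from_coords_coords[OF A]\<close>)
qed

end

section \<open>Lagrangian immersions into Kaehler manifolds\<close>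

locale lagrangian_in_kaehler =
  fixes A :: "('q::{t2_space, second_countable_topology}, complex ^ 'n) chart set"
    and g :: "'q \<Rightarrow> complex ^ 'n \<Rightarrow> complex ^ 'n \<Rightarrow> real"
    and J :: "'q \<Rightarrow> complex ^ 'n \<Rightarrow> complex ^ 'n"
    and \<Gamma> :: "('q, complex ^ 'n) chart \<Rightarrow> complex ^ 'n \<Rightarrow> complex ^ 'n \<Rightarrow> complex ^ 'n \<Rightarrow> complex ^ 'n"
    and B :: "('m::{t2_space, second_countable_topology}, real ^ 'n) chart set"
    and f :: "'m \<Rightarrow> 'q"
  assumes kaehler: "kaehler_manifold A g J \<Gamma>"
    and lagrangian: "lagrangian_immersion B A g J f"
begin

sublocale manifold_map B A f
  using kaehler lagrangian
  by unfold_locales (simp_all add: kaehler_manifold_def lagrangian_immersion_def immersion_def)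

lemma
  shows riemannian: "riemannian_metric A g" and almost_complex: "almost_complex_structure A J"
    and levi_civita: "levi_civita A g \<Gamma>" and parallel: "parallel_endo A \<Gamma> J"
    and hermitian: "g q (J q v) (J q w) = g q v w"
  using kaehler by (simp_all add: kaehler_manifold_def)

lemma metric: "inner_product_form (g q)"
  using riemannian by (simp add: riemannian_metric_def inner_product_form_def)

lemmas g_bilinear = inner_product_formD(1)[OF metric]
  and g_sym = inner_product_formD(2)[OF metric]

lemmas g_simps = bilinear_ladd[OF g_bilinear] bilinear_radd[OF g_bilinear]
  bilinear_lmul[OF g_bilinear] bilinear_rmul[OF g_bilinear] bilinear_lsub[OF g_bilinear]
  bilinear_rsub[OF g_bilinear] bilinear_lzero[OF g_bilinear] bilinear_rzero[OF g_bilinear]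

lemma linear_g_left: "linear (\<lambda>v. g q v w)" and linear_g_right: "linear (g q v)"
  using g_bilinear by (simp_all add: bilinear_def)

lemma linear_J: "linear (J q)" and J_J: "J q (J q v) = - v"
  using almost_complex by (simp_all add: almost_complex_structure_def)

lemma J_skew: "g q v (J q w) = - g q (J q v) w"
  using hermitian[of q v "J q w"] by (simp add: J_J bilinear_rneg[OF g_bilinear])

abbreviation L :: "'m \<Rightarrow> real ^ 'n \<Rightarrow> complex ^ 'n" where
  "L \<equiv> diff_map B A f"

abbreviation G :: "'m \<Rightarrow> real ^ 'n \<Rightarrow> real ^ 'n \<Rightarrow> real" where
  "G \<equiv> induced_metric B A g f"

abbreviation N :: "'m \<Rightarrow> (complex ^ 'n) set" where
  "N \<equiv> normal_space B A g f"

lemma inj_L: "inj (L p)"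
  using lagrangian by (simp add: lagrangian_immersion_def immersion_def)

lemma induced_metric_form: "inner_product_form (G p)"
  unfolding inner_product_form_def
proof (intro conjI allI impI)
  show "bilinear (G p)"
    by (simp add: bilinear_def linear_iff induced_metric_def linear_add[OF linear_diff_map]
        linear_cmul[OF linear_diff_map] g_simps)
  show "G p u v = G p v u" for u v
    by (simp add: induced_metric_def g_sym)
  show "G p u u > 0" if "u \<noteq> 0" for u
  proof -
    have "L p u \<noteq> 0"
      using that injD[OF inj_L, of p u 0] by (auto simp: linear_0[OF linear_diff_map])
    then show ?thesis
      by (simp add: induced_metric_def inner_product_formD(3)[OF metric])
  qed
qed

lemmas G_bilinear = inner_product_formD(1)[OF induced_metric_form]
  and G_sym = inner_product_formD(2)[OF induced_metric_form]

lemma linear_G_left: "linear (\<lambda>v. G p v w)" and linear_G_right: "linear (G p v)"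
  using G_bilinear by (simp_all add: bilinear_def)

lemma normal_space_iff: "\<xi> \<in> N p \<longleftrightarrow> (\<forall>u. g (f p) \<xi> (L p u) = 0)"
  by (auto simp: normal_space_def tangent_space_def)

lemma subspace_normal_space: "subspace (N p)"
  by (rule subspaceI) (auto simp: normal_space_iff g_simps)

text \<open>The Lagrangian condition enters here. It gives both that the Kaehler form vanishes on
  tangent vectors and that \<open>J\<close> composed with the differential identifies tangent with
  normal vectors.\<close>

lemma normal_space_eq: "N p = range (\<lambda>u. J (f p) (L p u))"
proof -
  have "N p = J (f p) ` range (L p)"
    using lagrangian by (simp add: lagrangian_immersion_def tangent_space_def)
  then show ?thesis by (simp add: image_image)
qed

lemma J_tangent_normal: "J (f p) (L p u) \<in> N p"
  by (simp add: normal_space_eq)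

lemma linear_JL: "linear (\<lambda>u. J (f p) (L p u))"
  using linear_compose[OF linear_diff_map linear_J] by (simp add: o_def)

lemma inj_JL: "inj (\<lambda>u. J (f p) (L p u))"
proof (rule injI)
  fix u v assume "J (f p) (L p u) = J (f p) (L p v)"
  then have "J (f p) (J (f p) (L p u)) = J (f p) (J (f p) (L p v))" by simp
  then show "u = v" by (simp add: J_J injD[OF inj_L])
qed

lemma dim_normal_space: "dim (N p) = CARD('n)"
  using dim_image_eq[OF linear_JL, of p UNIV] inj_JL[of p]
  by (simp add: normal_space_eq)

text \<open>An eigenframe of the identity is simply an orthonormal frame.\<close>

lemma orthonormal_frame_exists:
  obtains E :: "'n \<Rightarrow> real ^ 'n" where "orthonormal_wrt (G p) E"
  using self_adjoint_eigenframe[OF induced_metric_form linear_ident] by blast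

text \<open>Orthogonal projection, with coefficients read off in an orthonormal tangent frame. It
  supplies the existence needed for the definite description \<open>normal_part\<close>.\<close>

lemma tangential_projection_exists: "\<exists>u. w - L p u \<in> N p"
proof -
  obtain E :: "'n \<Rightarrow> real ^ 'n" where E: "orthonormal_wrt (G p) E"
    by (rule orthonormal_frame_exists)
  let ?u = "\<Sum>i\<in>UNIV. g (f p) w (L p (E i)) *\<^sub>R E i"
  have "g (f p) (L p ?u) (L p v) = g (f p) w (L p v)" for v
  proof -
    have "g (f p) (L p ?u) (L p v) = (\<Sum>i\<in>UNIV. g (f p) w (L p (E i)) * G p (E i) v)"
      unfolding induced_metric_def[of B A g f p, symmetric]
      by (simp add: linear_sum[OF linear_G_left[of p v]] linear_cmul[OF linear_G_left[of p v]])
    also have "\<dots> = g (f p) w (L p (\<Sum>i\<in>UNIV. G p v (E i) *\<^sub>R E i))"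
      by (simp add: linear_sum[OF linear_diff_map] linear_cmul[OF linear_diff_map] linear_sum[OF linear_g_right]
          linear_cmul[OF linear_g_right] G_sym[of p v] mult.commute)
    also have "\<dots> = g (f p) w (L p v)"
      by (simp flip: orthonormal_wrt_basis_expand[OF G_bilinear E])
    finally show ?thesis .
  qed
  then have "w - L p ?u \<in> N p"
    by (simp add: normal_space_iff g_simps)
  then show ?thesis by blast
qed

text \<open>The difference of two candidates is both normal and tangent, hence orthogonal to
  itself.\<close>

lemma normal_part_unique:
  assumes "\<xi> \<in> N p" "w = \<xi> + L p u"
  shows "normal_part B A g f p w = \<xi>"
  unfolding normal_part_def
proof (rule the_equality)
  show "\<xi> \<in> N p \<and> w - \<xi> \<in> tangent_space B A f p"
    using assms by (simp add: tangent_space_def)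
  fix \<zeta> assume \<zeta>: "\<zeta> \<in> N p \<and> w - \<zeta> \<in> tangent_space B A f p"
  then obtain v where v: "w - \<zeta> = L p v" by (auto simp: tangent_space_def)
  have diff: "\<zeta> - \<xi> = L p (u - v)"
    using v assms(2) by (simp add: linear_diff[OF linear_diff_map] algebra_simps)
  have "\<zeta> - \<xi> \<in> N p"
    using \<zeta> assms(1) subspace_normal_space by (simp add: subspace_diff)
  then have "g (f p) (\<zeta> - \<xi>) (\<zeta> - \<xi>) = 0"
    using diff by (simp add: normal_space_iff)
  then show "\<zeta> = \<xi>"
    by (simp add: inner_product_formD(5)[OF metric])
qed

lemma normal_part_decomposition:
  obtains u where "normal_part B A g f p w \<in> N p" "w = normal_part B A g f p w + L p u"
proof -
  obtain u where "w - L p u \<in> N p" using tangential_projection_exists by blast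
  with normal_part_unique[OF this, of w u] show thesis
    by (intro that[of u]) simp_all
qed

lemma normal_part_in: "normal_part B A g f p w \<in> N p"
  by (rule normal_part_decomposition)

lemma linear_normal_part: "linear (normal_part B A g f p)"
proof (rule linearI)
  fix v w
  obtain a where a: "v = normal_part B A g f p v + L p a" by (rule normal_part_decomposition)
  obtain b where b: "w = normal_part B A g f p w + L p b" by (rule normal_part_decomposition)
  show "normal_part B A g f p (v + w) = normal_part B A g f p v + normal_part B A g f p w"
  proof (rule normal_part_unique)
    show "v + w = normal_part B A g f p v + normal_part B A g f p w + L p (a + b)"
      using arg_cong2[OF a b, of plus] by (simp add: linear_add[OF linear_diff_map] algebra_simps)
  qed (simp add: subspace_add subspace_normal_space normal_part_in)
  fix r
  show "normal_part B A g f p (r *\<^sub>R v) = r *\<^sub>R normal_part B A g f p v"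
  proof (rule normal_part_unique)
    show "r *\<^sub>R v = r *\<^sub>R normal_part B A g f p v + L p (r *\<^sub>R a)"
      using arg_cong[OF a, of "\<lambda>x. r *\<^sub>R x"] by (simp add: linear_cmul[OF linear_diff_map] scaleR_right_distrib)
  qed (simp add: subspace_scale subspace_normal_space normal_part_in)
qed

lemma normal_part_tangent: "normal_part B A g f p (L p u) = 0"
  by (rule normal_part_unique[of _ _ _ u]) (simp_all add: subspace_0 subspace_normal_space)

lemma g_normal_part:
  assumes "\<xi> \<in> N p"
  shows "g (f p) (normal_part B A g f p w) \<xi> = g (f p) w \<xi>"
proof -
  obtain u where u: "w = normal_part B A g f p w + L p u" by (rule normal_part_decomposition)
  have "g (f p) w \<xi> = g (f p) (normal_part B A g f p w) \<xi> + g (f p) (L p u) \<xi>"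
    using arg_cong[OF u, of "\<lambda>x. g (f p) x \<xi>"] by (simp add: g_simps)
  then show ?thesis
    using assms by (simp add: normal_space_iff g_sym[of _ "L p u"])
qed

section \<open>Hessian of the immersion in the charts selected at a point and its image\<close>

definition second_derivative :: "'m \<Rightarrow> real ^ 'n \<Rightarrow> real ^ 'n \<Rightarrow> complex ^ 'n" where
  "second_derivative p u v = frechet_derivative
     (\<lambda>x. frechet_derivative (snd (chart_at A (f p)) \<circ> f \<circ> chart_inv (chart_at B p)) (at x) v)
     (at (snd (chart_at B p) p)) u"

text \<open>The ambient covariant derivative at \<open>p\<close>, in direction \<open>u\<close>, of
  \<open>df V\<close> for the field \<open>V\<close> with constant components \<open>v\<close> in
  the selected chart. Its tangential part depends on that chart; the normal part kept in
  \<open>h\<close> does not.\<close>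

definition ambient_hessian :: "'m \<Rightarrow> real ^ 'n \<Rightarrow> real ^ 'n \<Rightarrow> complex ^ 'n" where
  "ambient_hessian p u v =
     second_derivative p u v + \<Gamma> (chart_at A (f p)) (snd (chart_at A (f p)) (f p)) (L p u) (L p v)"

definition h :: "'m \<Rightarrow> real ^ 'n \<Rightarrow> real ^ 'n \<Rightarrow> complex ^ 'n" where
  "h p u v = normal_part B A g f p (ambient_hessian p u v)"

context
  fixes p :: 'm and c d x \<phi> S
  defines "c \<equiv> chart_at B p" and "d \<equiv> chart_at A (f p)" and "x \<equiv> snd c p"
    and "\<phi> \<equiv> snd d \<circ> f \<circ> chart_inv c" and "S \<equiv> snd c ` (fst c \<inter> f -` fst d)"
begin

lemma chart_facts:
  shows "c \<in> B" "d \<in> A" "p \<in> fst c" "f p \<in> fst d" "open S" "x \<in> S" "smooth_on S \<phi>"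
    "\<phi> x = snd d (f p)" "x \<in> snd c ` fst c" "\<phi> x \<in> snd d ` fst d" "chart_inv c x = p"
    "chart_inv d (\<phi> x) = f p" "\<phi> ` S \<subseteq> snd d ` fst d"
proof -
  show c: "c \<in> B" "p \<in> fst c" and d: "d \<in> A" "f p \<in> fst d"
    unfolding c_def d_def by (intro chart_at_in_atlas in_chart_at A B)+
  show "open S" "smooth_on S \<phi>"
    using open_domain[OF c(1) d(1) open_UNIV] smooth_local_map[OF c(1) d(1)] by (simp_all add: S_def \<phi>_def)
  show "x \<in> S" "x \<in> snd c ` fst c"
    using c d by (auto simp: S_def x_def)
  show x: "chart_inv c x = p"
    using c by (simp add: x_def chart_inv_chart[OF B])
  then show \<phi>x: "\<phi> x = snd d (f p)"
    by (simp add: \<phi>_def)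
  show "\<phi> x \<in> snd d ` fst d" "chart_inv d (\<phi> x) = f p"
    using d by (simp_all add: \<phi>x chart_inv_chart[OF A])
  show "\<phi> ` S \<subseteq> snd d ` fst d"
    using c by (auto simp: \<phi>_def S_def chart_inv_chart[OF B])
qed

lemma L_eq: "L p = frechet_derivative \<phi> (at x)"
  by (simp add: diff_map_def \<phi>_def x_def c_def d_def)

lemma second_derivative_eq:
  "second_derivative p u v = frechet_derivative (\<lambda>x. frechet_derivative \<phi> (at x) v) (at x) u"
  by (simp add: second_derivative_def \<phi>_def x_def c_def d_def)

lemma map_deriv_eq: "y \<in> S \<Longrightarrow> map_deriv c d f (chart_inv c y) = frechet_derivative \<phi> (at y)"
  using chart_facts by (auto simp: map_deriv_def \<phi>_def S_def chart_inv_chart[OF B])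

lemma bilinear_second_derivative: "bilinear (second_derivative p)"
  unfolding second_derivative_eq[abs_def]
  by (rule bilinear_second_frechet_derivative[OF chart_facts(5,7,6)])

lemma second_derivative_sym: "second_derivative p u v = second_derivative p v u"
  unfolding second_derivative_eq by (rule frechet_derivative_symmetric[OF chart_facts(5,7,6)])

lemma bilinear_christoffel: "y \<in> snd d ` fst d \<Longrightarrow> bilinear (\<Gamma> d y)"
  using levi_civita chart_facts(2) unfolding levi_civita_def by blast

text \<open>Torsion-freeness is tested on constant fields, whose derivatives vanish.\<close>

lemma christoffel_sym: "y \<in> snd d ` fst d \<Longrightarrow> \<Gamma> d y a b = \<Gamma> d y b a"
proof -
  assume y: "y \<in> snd d ` fst d"
  have "cov \<Gamma> d (\<lambda>y. a) (\<lambda>y. b) y - cov \<Gamma> d (\<lambda>y. b) (\<lambda>y. a) y =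
      frechet_derivative (\<lambda>y. b) (at y) a - frechet_derivative (\<lambda>y. a) (at y) b"
    using levi_civita chart_facts(2) smooth_on_const y unfolding levi_civita_def by blast
  then show ?thesis by (simp add: cov_def)
qed

lemma ambient_hessian_eq: "ambient_hessian p u v = second_derivative p u v + \<Gamma> d (\<phi> x) (L p u) (L p v)"
  by (simp add: ambient_hessian_def chart_facts(8) d_def)

lemma bilinear_ambient_hessian: "bilinear (ambient_hessian p)"
proof -
  note \<Gamma> = bilinear_christoffel[OF chart_facts(10)]
  show ?thesis
    unfolding bilinear_def linear_iff ambient_hessian_eq
    by (simp add: linear_add[OF linear_diff_map] linear_cmul[OF linear_diff_map]
        bilinear_ladd[OF \<Gamma>] bilinear_radd[OF \<Gamma>] bilinear_lmul[OF \<Gamma>] bilinear_rmul[OF \<Gamma>]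
        bilinear_ladd[OF bilinear_second_derivative] bilinear_radd[OF bilinear_second_derivative]
        bilinear_lmul[OF bilinear_second_derivative] bilinear_rmul[OF bilinear_second_derivative]
        scaleR_right_distrib)
qed

lemma ambient_hessian_sym: "ambient_hessian p u v = ambient_hessian p v u"
  by (simp add: ambient_hessian_eq second_derivative_sym[of u v] christoffel_sym[OF chart_facts(10), of "L p u"])

text \<open>Differentiating the components of \<open>Y\<close> contributes only a vector in the
  image of the differential. The normal projection kills it, so the second fundamental form depends
  on the fields only through their values at \<open>p\<close>.\<close>

lemma cov_along_diff_map:
  assumes "smooth_field_near B p Y"
  shows "\<exists>w. cov_along B A \<Gamma> f X (\<lambda>q. L q (Y q)) p = ambient_hessian p (X p) (Y p) + L p w"
proof -
  obtain U where U: "open U" "p \<in> U" "smooth_field B U Y"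
    using assms by (auto simp: smooth_field_near_def)
  let ?Y = "\<lambda>x. coords B c (chart_inv c x) (Y (chart_inv c x))"
  let ?F = "\<lambda>x. coords A d (f (chart_inv c x)) (L (chart_inv c x) (Y (chart_inv c x)))"
  let ?Y' = "frechet_derivative ?Y (at x)"
  have "x \<in> snd c ` (fst c \<inter> U)"
    using U(2) chart_facts by (auto simp: x_def)
  moreover have "open (snd c ` (fst c \<inter> U))"
    using chart_facts(1) U(1) by (rule open_chart_image[OF B])
  moreover have "smooth_on (snd c ` (fst c \<inter> U)) ?Y"
    using U(3) chart_facts(1) by (simp add: smooth_field_def)
  ultimately have "(?Y has_derivative ?Y') (at x)"
    by (intro smooth_on_has_derivative)
  then have "((\<lambda>y. frechet_derivative \<phi> (at y) (?Y y)) has_derivative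
      (\<lambda>u. second_derivative p u (?Y x) + L p (?Y' u))) (at x)"
    unfolding second_derivative_eq L_eq by (rule has_derivative_frechet_field[OF chart_facts(5,7,6)])
  then have "(?F has_derivative (\<lambda>u. second_derivative p u (?Y x) + L p (?Y' u))) (at x)"
    by (rule has_derivative_transform_within_open[OF _ chart_facts(5,6)])
      (use chart_facts in \<open>auto simp: map_deriv_eq[symmetric] coords_diff_map S_def chart_inv_chart[OF B]\<close>)
  from frechet_derivative_at[OF this, symmetric]
  have F': "frechet_derivative ?F (at x) u = second_derivative p u (?Y x) + L p (?Y' u)" for u
    by simp
  have "?Y x = Y p"
    using chart_facts(11) coords_chart_at[OF B] by (simp add: c_def)
  then have "cov_along B A \<Gamma> f X (\<lambda>q. L q (Y q)) p = ambient_hessian p (X p) (Y p) + L p (?Y' (X p))"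
    using F'[of "X p"] unfolding cov_along_def Let_def ambient_hessian_eq chart_facts(8)
    by (simp add: x_def c_def d_def)
  then show ?thesis by blast
qed

lemma local_metric_eq: "local_metric A g d (\<phi> x) a b = g (f p) a b"
  using chart_facts(12) from_coords_chart_at[OF A] by (simp add: local_metric_def d_def)

lemma local_endo_eq: "local_endo A J d (\<phi> x) a = J (f p) a"
  using chart_facts(12) from_coords_chart_at[OF A] coords_chart_at[OF A] by (simp add: local_endo_def d_def)

lemma bilinear_local_metric: "y \<in> snd d ` fst d \<Longrightarrow> bilinear (local_metric A g d y)"
proof -
  assume "y \<in> snd d ` fst d"
  then have "linear (from_coords A d (chart_inv d y))"
    using chart_facts(2) by (auto simp: chart_inv_chart[OF A] intro: linear_from_coords[OF A])
  then show ?thesis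
    by (simp add: bilinear_def linear_iff local_metric_def Let_def g_simps)
qed

lemma linear_local_endo_J: "y \<in> snd d ` fst d \<Longrightarrow> linear (local_endo A J d y)"
  by (intro linear_local_endo A chart_facts linear_J)

text \<open>\<open>K\<close> is the Kaehler form in the chart \<open>d\<close>.\<close>

definition "K y a b = local_metric A g d y a (local_endo A J d y b)"

lemma bilinear_K: "y \<in> snd d ` fst d \<Longrightarrow> bilinear (K y)"
  using bilinear_local_metric[of y] linear_local_endo_J[of y]
  unfolding K_def[abs_def] bilinear_def linear_iff by simp

text \<open>Metric compatibility is applied to the constant field \<open>a\<close> and to the
  nonconstant field obtained by applying \<open>J\<close> to \<open>b\<close>; parallelism of
  \<open>J\<close> then moves it outside the covariant derivative.\<close>

lemma K_parallel:
  "((\<lambda>y. K y a b) has_derivative (\<lambda>z. K (\<phi> x) (\<Gamma> d (\<phi> x) z a) b + K (\<phi> x) a (\<Gamma> d (\<phi> x) z b))) (at (\<phi> x))"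
proof -
  let ?D = "snd d ` fst d"
  have d: "d \<in> A" and D: "open ?D" and x: "\<phi> x \<in> ?D"
    using chart_facts open_chart_range[OF A] by simp_all
  have endo: "smooth_on ?D (\<lambda>y. local_endo A J d y b)"
    using almost_complex d by (simp add: almost_complex_structure_def)
  \<comment> \<open>The compatibility condition only prescribes the value of
    \<open>frechet_derivative\<close>, so differentiability has to be established
    separately.\<close>
  have "smooth_on ?D (\<lambda>y. K y a b)"
    unfolding K_def
  proof (rule smooth_on_linear_combination[OF D endo])
    show "smooth_on ?D (\<lambda>y. local_metric A g d y a j)" for j
      using riemannian d by (simp add: riemannian_metric_def)
    show "linear (local_metric A g d y a)" if "y \<in> ?D" for y
      using bilinear_local_metric[OF that] by (simp add: bilinear_def)
  qed
  then have "((\<lambda>y. K y a b) has_derivative frechet_derivative (\<lambda>y. K y a b) (at (\<phi> x))) (at (\<phi> x))"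
    using D x by (intro smooth_on_has_derivative)
  moreover have "frechet_derivative (\<lambda>y. K y a b) (at (\<phi> x)) z =
      K (\<phi> x) (\<Gamma> d (\<phi> x) z a) b + K (\<phi> x) a (\<Gamma> d (\<phi> x) z b)" for z
  proof -
    have "frechet_derivative (\<lambda>y. local_metric A g d y a (local_endo A J d y b)) (at (\<phi> x)) z =
        local_metric A g d (\<phi> x) (cov \<Gamma> d (\<lambda>y. z) (\<lambda>y. a) (\<phi> x)) (local_endo A J d (\<phi> x) b) +
        local_metric A g d (\<phi> x) a (cov \<Gamma> d (\<lambda>y. z) (\<lambda>y. local_endo A J d y b) (\<phi> x))"
      using levi_civita[unfolded levi_civita_def, THEN conjunct2, THEN conjunct2, rule_format,
          OF d smooth_on_const smooth_on_const endo x, of a z] .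
    moreover have "cov \<Gamma> d (\<lambda>y. z) (\<lambda>y. local_endo A J d y b) (\<phi> x) =
        local_endo A J d (\<phi> x) (cov \<Gamma> d (\<lambda>y. z) (\<lambda>y. b) (\<phi> x))"
      using parallel[unfolded parallel_endo_def, rule_format, OF d smooth_on_const smooth_on_const x, of z b] .
    ultimately show ?thesis
      by (simp add: K_def cov_def)
  qed
  ultimately show ?thesis
    by (rule has_derivative_eq_rhs[OF _ ext])
qed

text \<open>The vanishing is needed on a whole neighbourhood of \<open>x\<close>, since it is to be
  differentiated. At other points the fixed charts \<open>c\<close> and \<open>d\<close> need not be
  the selected ones, hence the conversion by \<open>from_coords\<close>.\<close>

lemma K_pullback_zero:
  assumes "y \<in> S"
  shows "K (\<phi> y) (frechet_derivative \<phi> (at y) v) (frechet_derivative \<phi> (at y) w) = 0"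
proof -
  define q where "q = chart_inv c y"
  have q: "q \<in> fst c" "f q \<in> fst d" "\<phi> y = snd d (f q)"
    using assms chart_facts by (auto simp: q_def S_def \<phi>_def chart_inv_chart[OF B])
  have D: "from_coords A d (f q) (frechet_derivative \<phi> (at y) v) = L q (from_coords B c q v)" for v
    using from_coords_map_deriv[OF chart_facts(1,2) q(1,2), of v] map_deriv_eq[OF assms] by (simp add: q_def)
  have "K (\<phi> y) (frechet_derivative \<phi> (at y) v) (frechet_derivative \<phi> (at y) w) =
      g (f q) (L q (from_coords B c q v)) (J (f q) (L q (from_coords B c q w)))"
    using q chart_facts(2)
    by (simp add: K_def local_metric_def local_endo_def Let_def chart_inv_chart[OF A] from_coords_coords[OF A] D)
  also have "\<dots> = 0"
    using J_tangent_normal[of q "from_coords B c q w"] by (simp add: normal_space_iff g_sym[of _ "L q _"])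
  finally show ?thesis .
qed

text \<open>A function that is identically zero on \<open>S\<close> is differentiated by the product
  rule. The Christoffel terms produced by \<open>K_parallel\<close> combine with the second
  derivatives into two Hessian terms.\<close>

lemma ambient_hessian_skew:
  "g (f p) (ambient_hessian p u v) (J (f p) (L p w)) + g (f p) (L p v) (J (f p) (ambient_hessian p u w)) = 0"
proof -
  let ?\<Gamma> = "\<Gamma> d (\<phi> x)" and ?K = "K (\<phi> x)"
  let ?D = "\<lambda>v y. frechet_derivative \<phi> (at y) v"
  note \<Gamma> = bilinear_christoffel[OF chart_facts(10)] and Kb = bilinear_K[OF chart_facts(10)]
  have D: "(?D v has_derivative (\<lambda>u. second_derivative p u v)) (at x)" for v
    unfolding second_derivative_eq
    by (intro smooth_on_has_derivative[of S] chart_facts smooth_on_frechet_derivative)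
  have bil: "bilinear (\<lambda>a b. ?K (?\<Gamma> z a) b + ?K a (?\<Gamma> z b))" for z
    by (simp add: bilinear_def linear_iff bilinear_ladd[OF Kb] bilinear_radd[OF Kb] bilinear_lmul[OF Kb]
        bilinear_rmul[OF Kb] bilinear_radd[OF \<Gamma>] bilinear_rmul[OF \<Gamma>] algebra_simps)
  have D1: "((\<lambda>y. K (\<phi> y) (?D v y) (?D w y)) has_derivative
      (\<lambda>u. (?K (?\<Gamma> (L p u) (?D v x)) (?D w x) + ?K (?D v x) (?\<Gamma> (L p u) (?D w x))) +
        ?K (second_derivative p u v) (?D w x) + ?K (?D v x) (second_derivative p u w))) (at x)"
  proof (rule has_derivative_bilinear_family[where h = K and \<phi> = \<phi> and V = "?D v" and W = "?D w" and \<phi>' = "L p"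
        and h' = "\<lambda>a b z. ?K (?\<Gamma> z a) b + ?K a (?\<Gamma> z b)",
        OF _ D D K_parallel open_chart_range[OF A chart_facts(2)] chart_facts(10) bilinear_K bil])
    show "(\<phi> has_derivative L p) (at x)"
      unfolding L_eq by (intro smooth_on_has_derivative[of S] chart_facts)
  qed
  have D2: "((\<lambda>y. K (\<phi> y) (?D v y) (?D w y)) has_derivative (\<lambda>u. 0)) (at x)"
    by (rule has_derivative_transform_within_open[OF has_derivative_const chart_facts(5,6)]) (simp add: K_pullback_zero)
  have "(?K (?\<Gamma> (L p u) (?D v x)) (?D w x) + ?K (?D v x) (?\<Gamma> (L p u) (?D w x))) +
        ?K (second_derivative p u v) (?D w x) + ?K (?D v x) (second_derivative p u w) = 0"
    using fun_cong[OF has_derivative_unique[OF D1 D2], of u] .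
  then have "?K (ambient_hessian p u v) (L p w) + ?K (L p v) (ambient_hessian p u w) = 0"
    by (simp add: ambient_hessian_eq L_eq[symmetric] bilinear_ladd[OF Kb] bilinear_radd[OF Kb])
  then show ?thesis
    by (simp add: K_def local_metric_eq local_endo_eq)
qed

text \<open>Every tangent vector extends to a smooth local field, so conditions quantified over
  fields become conditions on vectors.\<close>

lemma constant_field_near: "\<exists>X. smooth_field_near B p X \<and> X p = u"
proof (intro exI conjI)
  show "smooth_field_near B p (\<lambda>q. from_coords B c q u)"
    unfolding smooth_field_near_def
    using open_chart_domain[OF B] smooth_field_from_coords[OF B] chart_facts by blast
  show "from_coords B c p u = u"
    by (simp add: c_def from_coords_chart_at[OF B])
qed

end

section \<open>The second fundamental form as a symmetric bilinear map at a point\<close>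

lemma second_fundamental_form_eq:
  assumes "smooth_field_near B p Y"
  shows "second_fundamental_form B A g \<Gamma> f X Y p = h p (X p) (Y p)"
proof -
  obtain w where "cov_along B A \<Gamma> f X (\<lambda>q. L q (Y q)) p = ambient_hessian p (X p) (Y p) + L p w"
    using cov_along_diff_map[OF assms] by blast
  then show ?thesis
    by (simp add: second_fundamental_form_def h_def linear_add[OF linear_normal_part] normal_part_tangent)
qed

lemma linear_h_left: "linear (\<lambda>u. h p u v)" and linear_h_right: "linear (h p u)"
  using bilinear_ambient_hessian[of p] linear_normal_part[of p]
  by (auto simp: bilinear_def linear_iff h_def)

lemma h_sym: "h p u v = h p v u"
  by (simp add: h_def ambient_hessian_sym[of p u v])

lemma h_normal: "h p u v \<in> N p"
  by (simp add: h_def normal_part_in)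

text \<open>With \<open>h_sym\<close>, the cubic form is symmetric in all three arguments; this is what makes
  the tangential and the normal operator correspond under \<open>J\<close>.\<close>

lemma h_J_swap: "g (f p) (h p u v) (J (f p) (L p w)) = g (f p) (h p u w) (J (f p) (L p v))"
proof -
  have "g (f p) (h p u v) (J (f p) (L p w)) = g (f p) (ambient_hessian p u v) (J (f p) (L p w))"
    for v w by (simp add: h_def g_normal_part J_tangent_normal)
  moreover have "g (f p) (L p v) (J (f p) a) = - g (f p) a (J (f p) (L p v))" for a
    by (simp add: J_skew[of _ "L p v"] g_sym[of _ a])
  ultimately show ?thesis
    using ambient_hessian_skew[of p u v w] by simp
qed

lemma first_normal_space_eq: "first_normal_space B A g \<Gamma> f p = span {h p u v | u v. True}"
proof -
  have "{second_fundamental_form B A g \<Gamma> f X Y p | X Y. smooth_field_near B p X \<and> smooth_field_near B p Y} =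
      {h p u v | u v. True}" (is "?l = ?r")
  proof
    show "?l \<subseteq> ?r" using second_fundamental_form_eq by blast
    show "?r \<subseteq> ?l"
    proof
      fix \<xi> assume "\<xi> \<in> ?r"
      then obtain u v where "\<xi> = h p u v" by blast
      moreover obtain X Y where "smooth_field_near B p X" "X p = u" "smooth_field_near B p Y" "Y p = v"
        using constant_field_near by meson
      ultimately have "\<xi> = second_fundamental_form B A g \<Gamma> f X Y p"
        by (simp add: second_fundamental_form_eq)
      then show "\<xi> \<in> ?l"
        using \<open>smooth_field_near B p X\<close> \<open>smooth_field_near B p Y\<close> by blast
    qed
  qed
  then show ?thesis by (simp add: first_normal_space_def)
qed

lemma first_normal_space_maximal:
  assumes "dim (first_normal_space B A g \<Gamma> f p) = CARD('n)"
  shows "first_normal_space B A g \<Gamma> f p = N p"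
proof (rule subspace_dim_equal)
  show "first_normal_space B A g \<Gamma> f p \<subseteq> N p"
    unfolding first_normal_space_eq by (rule span_minimal) (auto simp: h_normal subspace_normal_space)
  show "dim (N p) \<le> dim (first_normal_space B A g \<Gamma> f p)"
    by (simp only: assms dim_normal_space)
qed (simp_all add: subspace_normal_space first_normal_space_eq)

text \<open>The definite description is resolved by representing the functionals
  \<open>v \<mapsto> g (h u v) \<xi>\<close> through the induced metric: existence in an orthonormal
  frame, uniqueness by nondegeneracy.\<close>

lemma shape_operator:
  shows linear_shape_operator: "linear (shape_operator B A g \<Gamma> f p \<xi>)"
    and G_shape_operator: "G p (shape_operator B A g \<Gamma> f p \<xi> u) v = g (f p) (h p u v) \<xi>"
proof -
  obtain E :: "'n \<Rightarrow> real ^ 'n" where E: "orthonormal_wrt (G p) E"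
    by (rule orthonormal_frame_exists)
  let ?P = "\<lambda>S. linear S \<and> (\<forall>X Y. smooth_field_near B p X \<longrightarrow> smooth_field_near B p Y \<longrightarrow>
    G p (S (X p)) (Y p) = g (f p) (second_fundamental_form B A g \<Gamma> f X Y p) \<xi>)"
  have P_iff: "?P S \<longleftrightarrow> linear S \<and> (\<forall>u v. G p (S u) v = g (f p) (h p u v) \<xi>)" for S
    using constant_field_near[of p] by (simp add: second_fundamental_form_eq) metis
  \<comment> \<open>The coefficients are the values of the functional to be represented on the
    orthonormal frame.\<close>
  define S where "S u = (\<Sum>i\<in>UNIV. g (f p) (h p u (E i)) \<xi> *\<^sub>R E i)" for u
  have S: "?P S"
    unfolding P_iff
  proof (intro conjI allI)
    show "linear S"
      by (rule linearI) (simp_all add: S_def linear_add[OF linear_h_left] linear_cmul[OF linear_h_left]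
          g_simps scaleR_left_distrib sum.distrib scaleR_sum_right)
    fix u v
    have "g (f p) (h p u v) \<xi> = g (f p) (h p u (\<Sum>i\<in>UNIV. G p v (E i) *\<^sub>R E i)) \<xi>"
      by (simp flip: orthonormal_wrt_basis_expand[OF G_bilinear E])
    also have "\<dots> = (\<Sum>i\<in>UNIV. G p v (E i) * g (f p) (h p u (E i)) \<xi>)"
      by (simp add: linear_sum[OF linear_h_right] linear_cmul[OF linear_h_right]
          linear_sum[OF linear_g_left] linear_cmul[OF linear_g_left])
    also have "\<dots> = G p (S u) v"
      by (simp add: S_def linear_sum[OF linear_G_left] linear_cmul[OF linear_G_left] G_sym[of p v] mult.commute)
    finally show "G p (S u) v = g (f p) (h p u v) \<xi>" ..
  qed
  have "shape_operator B A g \<Gamma> f p \<xi> = S"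
    unfolding shape_operator_def
  proof (rule the_equality)
    fix R assume "?P R"
    then have "G p (R u) v = G p (S u) v" for u v
      using S unfolding P_iff by simp
    then show "R = S"
      by (intro ext inner_product_form_ext[OF induced_metric_form])
  qed (rule S)
  then show "linear (shape_operator B A g \<Gamma> f p \<xi>)"
    "G p (shape_operator B A g \<Gamma> f p \<xi> u) v = g (f p) (h p u v) \<xi>"
    using S unfolding P_iff by simp_all
qed

text \<open>Indexing by tangent vectors turns the shape operators into a product on the tangent
  space. It will be commutative with self-adjoint multiplications; lowered by the metric it is the
  cubic form of the Lagrangian immersion.\<close>

definition shape :: "'m \<Rightarrow> real ^ 'n \<Rightarrow> real ^ 'n \<Rightarrow> real ^ 'n" where
  "shape p w = shape_operator B A g \<Gamma> f p (J (f p) (L p w))"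

lemma linear_shape: "linear (shape p w)"
  by (simp add: shape_def linear_shape_operator)

lemma shape_self_adjoint: "G p (shape p w u) v = G p u (shape p w v)"
  by (simp add: shape_def G_shape_operator G_sym[of p u] h_sym[of p u])

lemma shape_swap: "shape p w u = shape p u w"
proof (rule inner_product_form_ext[OF induced_metric_form])
  fix v
  show "G p (shape p w u) v = G p (shape p u w) v"
    unfolding shape_def G_shape_operator h_sym[of p _ v] by (rule h_J_swap)
qed

lemma orthonormal_JL: "orthonormal_wrt (g (f p)) (\<lambda>i. J (f p) (L p (E i))) \<longleftrightarrow> orthonormal_wrt (G p) E"
  by (simp add: orthonormal_wrt_def hermitian induced_metric_def)

lemma span_orthonormal_normal:
  fixes \<xi> :: "'n \<Rightarrow> complex ^ 'n"
  assumes "orthonormal_wrt (g (f p)) \<xi>" "range \<xi> \<subseteq> N p"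
  shows "span (range \<xi>) = N p"
  by (rule orthonormal_wrt_span[OF g_bilinear assms subspace_normal_space dim_normal_space])

text \<open>Every normal vector is \<open>J (L p u)\<close>, so the normal frame selected in both operators
  comes from a tangent frame.\<close>

definition frame :: "'m \<Rightarrow> 'n \<Rightarrow> real ^ 'n" where
  "frame p i = (SOME u. (SOME \<xi>. orthonormal_normal_frame B A g f p \<xi>) i = J (f p) (L p u))"

lemma
  shows J_frame: "(SOME \<xi>. orthonormal_normal_frame B A g f p \<xi>) = (\<lambda>i. J (f p) (L p (frame p i)))"
    and orthonormal_frame: "orthonormal_wrt (G p) (frame p)"
proof -
  define \<xi> :: "'n \<Rightarrow> complex ^ 'n" where "\<xi> = (SOME \<xi>. orthonormal_normal_frame B A g f p \<xi>)"
  obtain E :: "'n \<Rightarrow> real ^ 'n" where "orthonormal_wrt (G p) E"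
    by (rule orthonormal_frame_exists)
  \<comment> \<open>Without a witness the choice of \<open>\<xi>\<close> would carry no information;
    the \<open>J\<close>-image of any orthonormal tangent frame is one.\<close>
  then have "orthonormal_normal_frame B A g f p (\<lambda>i. J (f p) (L p (E i)))"
    unfolding orthonormal_normal_frame_def
    by (auto simp: orthonormal_JL J_tangent_normal intro!: span_orthonormal_normal)
  then have \<xi>: "orthonormal_normal_frame B A g f p \<xi>"
    unfolding \<xi>_def by (rule someI[of "orthonormal_normal_frame B A g f p"])
  have "\<xi> i = J (f p) (L p (frame p i))" for i
  proof -
    have "\<xi> i \<in> N p"
      using \<xi> span_base[of "\<xi> i" "range \<xi>"] by (auto simp: orthonormal_normal_frame_def)
    then have "\<exists>u. \<xi> i = J (f p) (L p u)"
      unfolding normal_space_eq by blast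
    then show ?thesis
      unfolding frame_def \<xi>_def by (rule someI_ex)
  qed
  then have eq: "\<xi> = (\<lambda>i. J (f p) (L p (frame p i)))"
    by (rule ext)
  then show "(SOME \<xi>. orthonormal_normal_frame B A g f p \<xi>) = (\<lambda>i. J (f p) (L p (frame p i)))"
    unfolding \<xi>_def .
  show "orthonormal_wrt (G p) (frame p)"
    using \<xi> unfolding orthonormal_normal_frame_def eq orthonormal_JL by blast
qed

section \<open>Casorati and Trencevski operators under the identification by
  \<open>J\<close>\<close>

lemma casorati_eq:
  "casorati_operator B A g \<Gamma> f p u = (\<Sum>\<alpha>\<in>UNIV. shape p (frame p \<alpha>) (shape p (frame p \<alpha>) u))"
  by (simp only: casorati_operator_def Let_def J_frame shape_def)

lemma trencevski_eq:
  "trencevski_operator B A g \<Gamma> f p (J (f p) (L p w)) =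
    (\<Sum>\<alpha>\<in>UNIV. trace (matrix (shape p w \<circ> shape p (frame p \<alpha>))) *\<^sub>R J (f p) (L p (frame p \<alpha>)))"
  by (simp only: trencevski_operator_def Let_def J_frame shape_def)

lemma linear_casorati: "linear (casorati_operator B A g \<Gamma> f p)"
  by (intro linearI)
    (simp_all add: casorati_eq linear_add[OF linear_shape] linear_cmul[OF linear_shape] sum.distrib scaleR_sum_right)

lemma casorati_self_adjoint:
  "G p (casorati_operator B A g \<Gamma> f p u) v = G p u (casorati_operator B A g \<Gamma> f p v)"
  by (simp only: casorati_eq linear_sum[OF linear_G_left] linear_sum[OF linear_G_right] shape_self_adjoint)

lemma trencevski_J:
  "trencevski_operator B A g \<Gamma> f p (J (f p) (L p w)) = J (f p) (L p (casorati_operator B A g \<Gamma> f p w))"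
proof -
  let ?E = "frame p"
  let ?cas = "casorati_operator B A g \<Gamma> f p"
  have "trace (matrix (shape p w \<circ> shape p (?E \<alpha>))) = G p (?cas w) (?E \<alpha>)" for \<alpha>
  proof -
    have "trace (matrix (shape p w \<circ> shape p (?E \<alpha>))) = (\<Sum>j\<in>UNIV. G p (shape p w (shape p (?E \<alpha>) (?E j))) (?E j))"
      using trace_orthonormal_wrt[OF G_bilinear orthonormal_frame linear_compose[OF linear_shape linear_shape]] by simp
    \<comment> \<open>Once one factor is moved across by self-adjointness, two swaps turn both
      factors into the shape operator of \<open>?E j\<close>. The index of the trace thereby becomes
      the summation index of the Casorati operator.\<close>
    also have "\<dots> = (\<Sum>j\<in>UNIV. G p (shape p (?E j) (?E \<alpha>)) (shape p (?E j) w))"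
      by (intro sum.cong refl)
        (simp only: shape_self_adjoint[of p w] shape_swap[of p w "?E _"] shape_swap[of p "?E \<alpha>"])
    also have "\<dots> = (\<Sum>j\<in>UNIV. G p (shape p (?E j) (shape p (?E j) w)) (?E \<alpha>))"
      by (intro sum.cong refl) (simp only: shape_self_adjoint[of p _ "?E \<alpha>"] G_sym[of p "?E \<alpha>"])
    also have "\<dots> = G p (?cas w) (?E \<alpha>)"
      by (simp add: casorati_eq linear_sum[OF linear_G_left])
    finally show ?thesis .
  qed
  \<comment> \<open>The traces are exactly the coordinates of the Casorati image of \<open>w\<close>
    in the chosen frame, so the sum reassembles that vector.\<close>
  then have "trencevski_operator B A g \<Gamma> f p (J (f p) (L p w)) =
      J (f p) (L p (\<Sum>\<alpha>\<in>UNIV. G p (?cas w) (?E \<alpha>) *\<^sub>R ?E \<alpha>))"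
    unfolding trencevski_eq by (simp add: linear_sum[OF linear_JL] linear_cmul[OF linear_JL])
  then show ?thesis
    by (simp flip: orthonormal_wrt_basis_expand[OF G_bilinear orthonormal_frame])
qed

lemma casorati_positive:
  assumes "dim (first_normal_space B A g \<Gamma> f p) = CARD('n)" "w \<noteq> 0"
  shows "G p (casorati_operator B A g \<Gamma> f p w) w > 0"
proof -
  let ?E = "frame p"
  have eq: "G p (casorati_operator B A g \<Gamma> f p w) w = (\<Sum>\<alpha>\<in>UNIV. G p (shape p (?E \<alpha>) w) (shape p (?E \<alpha>) w))"
    by (simp add: casorati_eq linear_sum[OF linear_G_left] shape_self_adjoint)
  have nonneg: "G p v v \<ge> 0" for v
    using inner_product_formD(4)[OF induced_metric_form] .
  have "\<exists>\<alpha>. shape p (?E \<alpha>) w \<noteq> 0"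
  proof (rule ccontr)
    assume "\<not> ?thesis"
    \<comment> \<open>The swap converts the vanishing of all frame shape operators at the single
      vector \<open>w\<close> into the vanishing of the single operator \<open>shape p w\<close> on
      a frame.\<close>
    then have zero: "shape p w (?E \<alpha>) = 0" for \<alpha>
      by (simp add: shape_swap[of p w])
    have "shape p w u = 0" for u
    proof -
      have "shape p w u = shape p w (\<Sum>\<alpha>\<in>UNIV. G p u (?E \<alpha>) *\<^sub>R ?E \<alpha>)"
        by (simp flip: orthonormal_wrt_basis_expand[OF G_bilinear orthonormal_frame])
      then show ?thesis
        by (simp add: linear_sum[OF linear_shape] linear_cmul[OF linear_shape] zero)
    qed
    then have "g (f p) (h p u v) (J (f p) (L p w)) = 0" for u v
      using G_shape_operator[of p "J (f p) (L p w)" u v]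
      by (simp add: bilinear_lzero[OF G_bilinear] flip: shape_def)
    then have "{h p u v | u v. True} \<subseteq> {\<xi>. g (f p) \<xi> (J (f p) (L p w)) = 0}"
      by blast
    moreover have "subspace {\<xi>. g (f p) \<xi> (J (f p) (L p w)) = 0}"
      by (rule subspaceI) (auto simp: g_simps)
    ultimately have "span {h p u v | u v. True} \<subseteq> {\<xi>. g (f p) \<xi> (J (f p) (L p w)) = 0}"
      by (rule span_minimal)
    then have "N p \<subseteq> {\<xi>. g (f p) \<xi> (J (f p) (L p w)) = 0}"
      using first_normal_space_maximal[OF assms(1)] unfolding first_normal_space_eq by simp
    then have "g (f p) (J (f p) (L p w)) (J (f p) (L p w)) = 0"
      using J_tangent_normal by blast
    then have "G p w w = 0"
      by (simp add: hermitian induced_metric_def)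
    then show False
      using assms(2) inner_product_formD(5)[OF induced_metric_form] by blast
  qed
  then obtain \<alpha> where "shape p (?E \<alpha>) w \<noteq> 0" by blast
  then have "G p (shape p (?E \<alpha>) w) (shape p (?E \<alpha>) w) > 0"
    using inner_product_formD(3)[OF induced_metric_form] by blast
  then show ?thesis
    unfolding eq by (intro sum_pos2[of _ \<alpha>]) (simp_all add: nonneg)
qed

text \<open>All conditions are pointwise, so \<open>U\<close> may be any set and the eigenframe need
  have no regularity. This allows the same lemma to serve arbitrary global and smooth local
  eigenframes.\<close>

lemma principal_casorati_tangential_imp:
  assumes max: "\<And>p. p \<in> U \<Longrightarrow> dim (first_normal_space B A g \<Gamma> f p) = CARD('n)"
    and F: "principal_casorati_tangential B A g \<Gamma> f U F c"
  shows "adapted_orthonormal_frame B A g f U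
      (case_sum (\<lambda>i p. L p (F i p)) (\<lambda>i p. J (f p) (L p (F i p))))"
    and "principal_casorati_normal B A g \<Gamma> f U (\<lambda>i p. J (f p) (L p (F i p))) c"
proof -
  have ortho: "orthonormal_wrt (G p) (\<lambda>i. F i p)" and
    eigen: "casorati_operator B A g \<Gamma> f p (F i p) = c i p *\<^sub>R F i p" if "p \<in> U" for p i
    using F that by (simp_all add: principal_casorati_tangential_def)
  have LJ: "g (f p) (L p u) (J (f p) (L p v)) = 0" "g (f p) (J (f p) (L p v)) (L p u) = 0" for p u v
    using J_tangent_normal[of p v] by (simp_all add: normal_space_iff g_sym[of _ "L p u"])
  show "adapted_orthonormal_frame B A g f U
      (case_sum (\<lambda>i p. L p (F i p)) (\<lambda>i p. J (f p) (L p (F i p))))"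
    unfolding adapted_orthonormal_frame_def
  proof (intro ballI conjI allI)
    fix p assume "p \<in> U"
    then show "orthonormal_wrt (g (f p))
        (\<lambda>k. case_sum (\<lambda>i p. L p (F i p)) (\<lambda>i p. J (f p) (L p (F i p))) k p)"
      using ortho[of p] by (auto simp: orthonormal_wrt_def LJ hermitian induced_metric_def split: sum.split)
  qed (simp_all add: tangent_space_def J_tangent_normal)
  show "principal_casorati_normal B A g \<Gamma> f U (\<lambda>i p. J (f p) (L p (F i p))) c"
    unfolding principal_casorati_normal_def
  proof (intro ballI conjI allI)
    fix p i assume p: "p \<in> U"
    show o: "orthonormal_wrt (g (f p)) (\<lambda>i. J (f p) (L p (F i p)))"
      using ortho[OF p] by (simp add: orthonormal_JL)
    then show "span (range (\<lambda>i. J (f p) (L p (F i p)))) = first_normal_space B A g \<Gamma> f p"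
      unfolding first_normal_space_maximal[OF max[OF p]]
      by (rule span_orthonormal_normal) (auto simp: J_tangent_normal)
    show "trencevski_operator B A g \<Gamma> f p (J (f p) (L p (F i p))) = c i p *\<^sub>R J (f p) (L p (F i p))"
      by (simp add: trencevski_J eigen[OF p] linear_cmul[OF linear_JL])
    have FF: "G p (F i p) (F i p) = 1"
      using ortho[OF p] by (simp add: orthonormal_wrt_def)
    then have "F i p \<noteq> 0"
      by (auto simp: bilinear_lzero[OF G_bilinear])
    \<comment> \<open>On a unit eigenvector the quadratic form of the Casorati operator equals the
      eigenvalue.\<close>
    from casorati_positive[OF max[OF p] this] show "c i p > 0"
      by (simp add: eigen[OF p] bilinear_lmul[OF G_bilinear] FF)
  qed
qed

lemma principal_casorati_tangential_exists:
  "\<exists>F c. principal_casorati_tangential B A g \<Gamma> f UNIV F c"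
proof -
  \<comment> \<open>Frame and eigenvalues are paired so that one choice yields both. It is made
    independently at each point, so no regularity in \<open>p\<close> results.\<close>
  have "\<forall>p. \<exists>Ec :: ('n \<Rightarrow> real ^ 'n) \<times> ('n \<Rightarrow> real). orthonormal_wrt (G p) (fst Ec) \<and>
      (\<forall>i. casorati_operator B A g \<Gamma> f p (fst Ec i) = snd Ec i *\<^sub>R fst Ec i)"
  proof
    fix p
    have "\<exists>(E :: 'n \<Rightarrow> real ^ 'n) c. orthonormal_wrt (G p) E \<and>
        (\<forall>i. casorati_operator B A g \<Gamma> f p (E i) = c i *\<^sub>R E i)"
      by (intro self_adjoint_eigenframe induced_metric_form linear_casorati casorati_self_adjoint)
    then obtain E :: "'n \<Rightarrow> real ^ 'n" where "\<exists>c. orthonormal_wrt (G p) E \<and>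
        (\<forall>i. casorati_operator B A g \<Gamma> f p (E i) = c i *\<^sub>R E i)" ..
    then obtain c where "orthonormal_wrt (G p) E \<and>
        (\<forall>i. casorati_operator B A g \<Gamma> f p (E i) = c i *\<^sub>R E i)" ..
    then show "\<exists>Ec :: ('n \<Rightarrow> real ^ 'n) \<times> ('n \<Rightarrow> real). orthonormal_wrt (G p) (fst Ec) \<and>
        (\<forall>i. casorati_operator B A g \<Gamma> f p (fst Ec i) = snd Ec i *\<^sub>R fst Ec i)"
      by (intro exI[of _ "(E, c)"]) simp
  qed
  from choice[OF this] obtain Ec :: "'m \<Rightarrow> ('n \<Rightarrow> real ^ 'n) \<times> ('n \<Rightarrow> real)"
    where "\<forall>p. orthonormal_wrt (G p) (fst (Ec p)) \<and>
      (\<forall>i. casorati_operator B A g \<Gamma> f p (fst (Ec p) i) = snd (Ec p) i *\<^sub>R fst (Ec p) i)" ..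
  then have "principal_casorati_tangential B A g \<Gamma> f UNIV (\<lambda>i p. fst (Ec p) i) (\<lambda>i p. snd (Ec p) i)"
    unfolding principal_casorati_tangential_def by simp
  then show ?thesis by (intro exI)
qed

end

text \<open>Existence and smoothness are separated because an eigenframe of a smooth family of
  self-adjoint operators need not be choosable continuously where eigenvalues meet. Pointwise a
  frame exists everywhere; over an open set every smooth tangential eigenframe yields a smooth
  adapted one.\<close>

theorem theorem2:
  fixes A :: "('q::{t2_space, second_countable_topology}, complex ^ 'n) chart set"
    and g :: "'q \<Rightarrow> complex ^ 'n \<Rightarrow> complex ^ 'n \<Rightarrow> real"
    and J :: "'q \<Rightarrow> complex ^ 'n \<Rightarrow> complex ^ 'n"
    and \<Gamma> :: "('q, complex ^ 'n) chart \<Rightarrow> complex ^ 'n \<Rightarrow> complex ^ 'n \<Rightarrow> complex ^ 'n \<Rightarrow> complex ^ 'n"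
    and B :: "('m::{t2_space, second_countable_topology}, real ^ 'n) chart set"
    and f :: "'m \<Rightarrow> 'q"
  assumes "CARD('n) \<ge> 2"
    and "kaehler_manifold A g J \<Gamma>"
    and "lagrangian_immersion B A g J f"
    and "\<forall>p. dim (first_normal_space B A g \<Gamma> f p) = CARD('n)"
  shows "(\<exists>(F :: 'n \<Rightarrow> 'm \<Rightarrow> real ^ 'n) c.
            adapted_orthonormal_frame B A g f UNIV
              (case_sum (\<lambda>i p. diff_map B A f p (F i p)) (\<lambda>i p. J (f p) (diff_map B A f p (F i p)))) \<and>
            principal_casorati_tangential B A g \<Gamma> f UNIV F c \<and>
            principal_casorati_normal B A g \<Gamma> f UNIV (\<lambda>i p. J (f p) (diff_map B A f p (F i p))) c)
       \<and> (\<forall>U (F :: 'n \<Rightarrow> 'm \<Rightarrow> real ^ 'n) c.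
            open U \<longrightarrow> (\<forall>i. smooth_field B U (F i)) \<longrightarrow>
            principal_casorati_tangential B A g \<Gamma> f U F c \<longrightarrow>
            adapted_orthonormal_frame B A g f U
              (case_sum (\<lambda>i p. diff_map B A f p (F i p)) (\<lambda>i p. J (f p) (diff_map B A f p (F i p)))) \<and>
            principal_casorati_normal B A g \<Gamma> f U (\<lambda>i p. J (f p) (diff_map B A f p (F i p))) c \<and>
            (\<forall>i. smooth_field_along B A f U (\<lambda>p. diff_map B A f p (F i p)) \<and>
                 smooth_field_along B A f U (\<lambda>p. J (f p) (diff_map B A f p (F i p)))))"
proof -
  interpret lagrangian_in_kaehler A g J \<Gamma> B f
    using assms(2,3) by unfold_locales
  note frame = principal_casorati_tangential_imp[OF assms(4)[rule_format]]
  obtain F :: "'n \<Rightarrow> 'm \<Rightarrow> real ^ 'n" and c where F: "principal_casorati_tangential B A g \<Gamma> f UNIV F c"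
    using principal_casorati_tangential_exists by blast
  show ?thesis
  proof (intro conjI allI impI)
    show "\<exists>(F :: 'n \<Rightarrow> 'm \<Rightarrow> real ^ 'n) c.
        adapted_orthonormal_frame B A g f UNIV
          (case_sum (\<lambda>i p. L p (F i p)) (\<lambda>i p. J (f p) (L p (F i p)))) \<and>
        principal_casorati_tangential B A g \<Gamma> f UNIV F c \<and>
        principal_casorati_normal B A g \<Gamma> f UNIV (\<lambda>i p. J (f p) (L p (F i p))) c"
      by (intro exI[of _ F] exI[of _ c] conjI F frame[OF F])
  next
    fix U and F :: "'n \<Rightarrow> 'm \<Rightarrow> real ^ 'n" and c and i :: 'n
    assume U: "open U" and smooth: "\<forall>i. smooth_field B U (F i)"
      and F: "principal_casorati_tangential B A g \<Gamma> f U F c"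
    show "adapted_orthonormal_frame B A g f U
        (case_sum (\<lambda>i p. L p (F i p)) (\<lambda>i p. J (f p) (L p (F i p))))"
      using F by (rule frame(1))
    show "principal_casorati_normal B A g \<Gamma> f U (\<lambda>i p. J (f p) (L p (F i p))) c"
      using F by (rule frame(2))
    show "smooth_field_along B A f U (\<lambda>p. L p (F i p))"
      using U smooth by (intro smooth_field_along_diff_map) simp_all
    then show "smooth_field_along B A f U (\<lambda>p. J (f p) (L p (F i p)))"
      by (rule smooth_field_along_endo[OF U _ almost_complex])
  qed
qed

end
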